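(* Let $p$ be a prime, $m\ge 2$ an integer, and $\chi$ a character mod $p^m$. Let $G(\chi,p^m)=\sum_{x=1}^{p^m}\chi(x)e_{p^m}(x)$, where $e_y(x)=e^{2\pi i x/y}$, and let $\omega=e^{\pi i/4}$. If $\chi$ is imprimitive, then $G(\chi,p^m)=0$. If $\chi$ is primitive, then $$G(\chi,p^m)=p^{\frac m2}\,\chi\left(-cR_j^{-1}\right)e_{p^m}\left(-cR_j^{-1}\right)\begin{cases}\left(\dfrac{-2rc}{p}\right)^m\varepsilon_{p^m}, & \text{if } p\ne 2,\\[2mm] \left(\dfrac{2}{c}\right)^m\omega^c, & \text{if } p=2 \text{ and } m\ge 5,\end{cases}$$ for any $j\ge\lceil \frac m2\rceil$ when $p$ is odd and any $j\ge\lceil\frac m2\rceil+2$ when $p=2$. Here $x^{-1}$ denotes the inverse of $x$ mod $p^m$, and $r$, $R_j$, $c$ are defined in the context. For the remaining cases ($p=2$, $m=2,3,4$, $\chi$ primitive mod $2^m$), $$G(\chi,2^m)=2^{\frac m2}\begin{cases} i, & \text{if } m=2,\\ \omega^{1-\chi(-1)}, & \text{if } m=3,\\ \chi(-c)e_{16}(-c), & \text{if } m=4.\end{cases}$$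
   Context: A character mod $q$ is a multiplicative (Dirichlet) character, with $\chi(x)=0$ when $\gcd(x,q)>1$. $\left(\frac{\cdot}{\cdot}\right)$ is the Jacobi symbol. $\varepsilon_{p^m}:=1$ if $p^m\equiv 1\bmod 4$ and $\varepsilon_{p^m}:=i$ if $p^m\equiv 3\bmod 4$. For $p$ odd: let $a$ be a primitive root mod $p^m$. The integers $r$ and $R_j$ are defined by $a^{\phi(p)}=1+rp$ and $a^{\phi(p^j)}=1+R_jp^j$ (one has $p\nmid r$). The integer $c$ is defined by $\chi(a)=e_{\phi(p^m)}(c)$, $1\le c\le\phi(p^m)$; $\chi$ is primitive exactly when $p\nmid c$. For $p=2$ and $m\ge 3$: $-1$ and $a=5$ generate $(\mathbb Z/2^m\mathbb Z)^*$. The integers $R_j$ ($j\ge 2$) are defined by $5^{2^{j-2}}=1+R_j2^j$, and $c$ is defined by $\chi(5)=e_{2^{m-2}}(c)$; $\chi$ is primitive exactly when $c$ is odd.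
   Formalization: The formula for odd p and primitive χ is stated only for p^m ≠ 27: for p^m = 27 it is false for every primitive χ, the true value being the stated one times e_3(-rc) (e.g. a = 2, c = 1, j = 2). The imprimitive case still includes 27. *)

theory Defs
  imports "HOL-Analysis.Analysis" "HOL-Number_Theory.Number_Theory"
begin

text \<open>Characters mod \<open>q\<close> are functions on all of \<open>\<int>\<close>, extended by zero to
  the integers not coprime to \<open>q\<close>.\<close>

definition dirichlet_character :: "nat \<Rightarrow> (int \<Rightarrow> complex) \<Rightarrow> bool" where
  "dirichlet_character q chi \<longleftrightarrow>
     chi 1 = 1 \<and>
     (\<forall>x y. chi (x * y) = chi x * chi y) \<and>
     (\<forall>x. chi (x + int q) = chi x) \<and>
     (\<forall>x. \<not> coprime x (int q) \<longrightarrow> chi x = 0)"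

text \<open>\<open>d\<close> is an induced modulus of \<open>chi\<close> if \<open>chi\<close>, as a character of the group
  of units mod \<open>q\<close>, factors through the units mod \<open>d\<close>, i.e.\ is trivial on the
  kernel of the reduction map.\<close>

definition induced_modulus :: "nat \<Rightarrow> (int \<Rightarrow> complex) \<Rightarrow> nat \<Rightarrow> bool" where
  "induced_modulus q chi d \<longleftrightarrow>
     d dvd q \<and> (\<forall>x. coprime x (int q) \<and> [x = 1] (mod int d) \<longrightarrow> chi x = 1)"

definition primitive_character :: "nat \<Rightarrow> (int \<Rightarrow> complex) \<Rightarrow> bool" where
  "primitive_character q chi \<longleftrightarrow>
     dirichlet_character q chi \<and> \<not> (\<exists>d<q. induced_modulus q chi d)"

definition e_mod :: "nat \<Rightarrow> int \<Rightarrow> complex" where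
  "e_mod y x = exp (2 * of_real pi * \<i> * of_int x / of_nat y)"

definition gauss_sum :: "(int \<Rightarrow> complex) \<Rightarrow> nat \<Rightarrow> complex" where
  "gauss_sum chi q = (\<Sum>x = 1..int q. chi x * e_mod q x)"

text \<open>The Jacobi symbol \<open>(a / n)\<close>; only meant for odd \<open>n > 0\<close>.\<close>

definition Jacobi :: "int \<Rightarrow> nat \<Rightarrow> int" where
  "Jacobi a n = (\<Prod>p\<in>#prime_factorization n. Legendre a (int p))"

text \<open>Only meant for odd \<open>n\<close>, so that the second case is \<open>n\<close> congruent to 3 mod 4.\<close>

definition eps :: "nat \<Rightarrow> complex" where
  "eps n = (if [n = 1] (mod 4) then 1 else \<i>)"

definition omega :: complex where
  "omega = exp (of_real pi * \<i> / 4)"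

text \<open>The library's \<^const>\<open>residue_primroot\<close> takes a natural number; an integer is a
  primitive root iff its least non-negative residue is.\<close>

definition primitive_root :: "nat \<Rightarrow> int \<Rightarrow> bool" where
  "primitive_root n a \<longleftrightarrow> residue_primroot n (nat (a mod int n))"

end

theory Submission
  imports Defs
begin

text \<open>
  The argument is a discrete stationary phase; \<open>e x\<close> stands for \<open>exp (2 * pi * \<i> * x)\<close> below.
  Split \<open>m = h + n\<close> with \<open>n\<close> the upper half of \<open>m\<close>. Because \<open>2 * n \<ge> m\<close>, the map
  \<open>t \<mapsto> chi (1 + p^n * t)\<close> is an additive character modulo \<open>p^h\<close>, say \<open>t \<mapsto> e (b * t / p^h)\<close>. Multiplying the summation variable by
  \<open>1 + p^n * t\<close> does not change the Gauss sum; averaging over \<open>t\<close> kills every term except those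
  with \<open>x\<close> congruent to \<open>- b\<close> modulo \<open>p^h\<close> (\<open>gauss_sum_concentrated\<close>). For an imprimitive
  character the same averaging with \<open>m - 1\<close> instead of \<open>n\<close> leaves only multiples of \<open>p\<close>,
  where \<open>chi\<close> vanishes. For a primitive character \<open>b\<close> is a unit, the surviving \<open>x\<close> are the
  \<open>x0 * (1 + p^h * t)\<close>, and the sum becomes \<open>p^h * chi x0 * e (x0 / p^m)\<close> times a sum of
  \<open>p^(n - h)\<close> local factors (\<open>gauss_sum_reduced\<close>): one term for even \<open>m\<close>, and \<open>p\<close> terms for
  odd \<open>m\<close>.

  The stationary point is found by evaluating \<open>chi\<close> at \<open>a^\<phi>(p^i) = 1 + R_i * p^i\<close> in two ways,
  which gives \<open>c = b * R_n\<close> modulo \<open>p^h\<close>. For odd \<open>p\<close> the quotients \<open>R_i\<close> are \<open>p\<close>-adically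
  coherent, so \<open>- c / R_j\<close> is a legitimate \<open>x0\<close> for every \<open>j \<ge> n\<close>. If \<open>m\<close> is odd, the
  local factor is a function \<open>F\<close> on the residues modulo \<open>p\<close> with
  \<open>F (s + t) = F s * F t * e (- b * s * t / p)\<close>, hence a quadratic phase times an additive character; evaluating it at the single point \<open>R_h\<close> shows
  that this character is trivial at \<open>x0 = - c / R_j\<close>, and the local sum is a quadratic Gauss
  sum. That evaluation needs \<open>R_{h+1}\<close> modulo \<open>p^{h+1}\<close> up to quadratic terms in \<open>R_h\<close>; for
  \<open>p = 3\<close>, \<open>h = 1\<close> the cubic term of the binomial expansion survives as well, which is why the
  modulus 27 is exceptional.

  The sign of the quadratic Gauss sum is obtained as Gauss did it: his identity for alternating
  sums of \<open>q\<close>-binomial coefficients, taken at a root of unity, turns the sum into a product of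
  sines whose signs can be counted (\<open>quadratic_gauss_sum_1\<close>).

  For \<open>p = 2\<close> the quotients of the powers of 5 obey the exact recursion
  \<open>R_{j+1} = R_j + 2^{j-1} * R_j^2\<close>, so \<open>R_j = R_i + 7 * 2^{i-1}\<close> modulo \<open>2^{i+2}\<close> for
  \<open>j \<ge> i + 3\<close>, and \<open>R_j = - 1\<close> modulo 8 from \<open>j = 4\<close> on. For odd \<open>m\<close> the two local factors
  then add up to \<open>1 + \<i>^c\<close>. For even \<open>m\<close> the point \<open>- c / R_j\<close> misses the stationary class by
  the factor \<open>5^(2^(n-3))\<close>, and moving it there costs exactly \<open>omega^c\<close>.
\<close>

section \<open>Exponentials and sums over residue systems\<close>

lemma e_mod_0 [simp]: "e_mod N 0 = 1"
  by (simp add: e_mod_def)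

lemma e_mod_add: "e_mod N (x + y) = e_mod N x * e_mod N y"
  unfolding e_mod_def
  by (subst exp_add [symmetric]) (simp add: add_divide_distrib distrib_left)

lemma e_mod_minus: "e_mod N (- x) = inverse (e_mod N x)"
  by (simp add: e_mod_def exp_minus)

lemma e_mod_diff: "e_mod N (x - y) = e_mod N x / e_mod N y"
  using e_mod_add [of N x "- y"] by (simp add: e_mod_minus divide_inverse)

lemma e_mod_nonzero [simp]: "e_mod N x \<noteq> 0"
  by (simp add: e_mod_def)

lemma e_mod_mult_nat: "e_mod N (x * int k) = e_mod N x ^ k"
  by (induction k) (simp_all add: distrib_left e_mod_add)

lemma cnj_e_mod: "cnj (e_mod N x) = e_mod N (- x)"
  by (simp add: e_mod_def exp_cnj)

lemma e_mod_cancel: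
  assumes "d > 0"
  shows "e_mod (N * d) (x * int d) = e_mod N x"
  using assms by (simp add: e_mod_def mult.assoc)

lemma e_mod_eq_1_iff:
  assumes "N > 0"
  shows "e_mod N x = 1 \<longleftrightarrow> int N dvd x"
proof -
  have "e_mod N x = 1 \<longleftrightarrow> (\<exists>k::int. 2 * pi * real_of_int x / real N = real_of_int (2 * k) * pi)"
    by (simp add: e_mod_def exp_eq_1)
  also have "\<dots> \<longleftrightarrow> (\<exists>k::int. real_of_int x = real_of_int (int N * k))"
    using assms by (intro ex_cong1) (auto simp: field_simps)
  also have "\<dots> \<longleftrightarrow> int N dvd x"
    unfolding of_int_eq_iff dvd_def ..
  finally show ?thesis .
qed

lemma e_mod_cong:
  assumes "[x = y] (mod int N)"
  shows "e_mod N x = e_mod N y"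
proof (cases "N = 0")
  case True
  with assms show ?thesis by simp
next
  case False
  have "int N dvd x - y"
    using assms by (simp add: cong_iff_dvd_diff)
  then have "e_mod N (x - y) = 1"
    using False e_mod_eq_1_iff by simp
  then show ?thesis
    by (simp add: e_mod_diff)
qed

lemma e_mod_eq_iff:
  assumes "N > 0"
  shows "e_mod N x = e_mod N y \<longleftrightarrow> [x = y] (mod int N)"
proof -
  have "e_mod N x = e_mod N y \<longleftrightarrow> e_mod N (x - y) = 1"
    by (simp add: e_mod_diff)
  then show ?thesis
    using assms by (simp add: e_mod_eq_1_iff cong_iff_dvd_diff)
qed

definition periodic_mod :: "nat \<Rightarrow> (int \<Rightarrow> 'a) \<Rightarrow> bool" where
  "periodic_mod N f \<longleftrightarrow> (\<forall>x y. [x = y] (mod int N) \<longrightarrow> f x = f y)"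

lemma periodic_modI:
  assumes "\<And>x. f (x + int N) = f x"
  shows "periodic_mod N f"
proof -
  have nat: "f (x + int N * int k) = f x" for x k
    by (induction k) (use assms [of "x + int N * int _"] in \<open>auto simp: algebra_simps\<close>)
  have "f (x + int N * k) = f x" for x k
  proof (cases "k \<ge> 0")
    case True
    then show ?thesis using nat [of x "nat k"] by simp
  next
    case False
    then show ?thesis using nat [of "x + int N * k" "nat (- k)"] by simp
  qed
  then show ?thesis
    unfolding periodic_mod_def cong_iff_lin by metis
qed

lemma periodic_modD: "periodic_mod N f \<Longrightarrow> [x = y] (mod int N) \<Longrightarrow> f x = f y"
  by (auto simp: periodic_mod_def)

lemma sum_residues_affine:
  fixes f :: "int \<Rightarrow> 'a :: comm_monoid_add"
  assumes f: "periodic_mod N f" and "N > 0" and u: "coprime u (int N)"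
  shows "(\<Sum>x\<in>{0..<int N}. f (u * x + v)) = (\<Sum>x\<in>{0..<int N}. f x)"
proof -
  let ?g = "\<lambda>x. (u * x + v) mod int N"
  have inj: "inj_on ?g {0..<int N}"
  proof (rule inj_onI)
    fix x y assume xy: "x \<in> {0..<int N}" "y \<in> {0..<int N}" "?g x = ?g y"
    then have "[u * x + v = u * y + v] (mod int N)"
      by (simp add: cong_def)
    then have "[u * x = u * y] (mod int N)"
      using cong_add_rcancel by blast
    then have "[x = y] (mod int N)"
      using u cong_mult_lcancel by blast
    then show "x = y"
      using xy by (auto intro: cong_less_imp_eq_int)
  qed
  moreover have "?g ` {0..<int N} \<subseteq> {0..<int N}"
    using \<open>N > 0\<close> by auto
  ultimately have "bij_betw ?g {0..<int N} {0..<int N}"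
    by (simp add: bij_betw_def endo_inj_surj)
  then have "(\<Sum>x\<in>{0..<int N}. f x) = (\<Sum>x\<in>{0..<int N}. f (?g x))"
    by (rule sum.reindex_bij_betw [symmetric])
  also have "\<dots> = (\<Sum>x\<in>{0..<int N}. f (u * x + v))"
    by (intro sum.cong periodic_modD [OF f]) auto
  finally show ?thesis ..
qed

text \<open>Used in two ways: to restrict a sum to one class modulo \<open>N\<close>, and to evaluate the sum of a
  function of small period over a long range.\<close>

lemma sum_residues_split:
  fixes f :: "int \<Rightarrow> 'a :: comm_monoid_add"
  assumes "N > 0"
  shows "(\<Sum>x\<in>{0..<int (N * M)}. f x) = (\<Sum>a\<in>{0..<int N}. \<Sum>t\<in>{0..<int M}. f (a + int N * t))"
proof -
  have "(\<Sum>x\<in>{0..<int (N * M)}. f x) = (\<Sum>(a, t)\<in>{0..<int N} \<times> {0..<int M}. f (a + int N * t))"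
  proof (rule sum.reindex_bij_witness
      [of _ "\<lambda>(a, t). a + int N * t" "\<lambda>x. (x mod int N, x div int N)"], goal_cases)
    case (1 x)
    then show ?case by simp
  next
    case (2 x)
    then have "0 \<le> x div int N"
      using assms by (simp add: pos_imp_zdiv_nonneg_iff)
    moreover have "x div int N < int M"
    proof (rule ccontr)
      assume "\<not> x div int N < int M"
      then have "int N * int M \<le> int N * (x div int N)"
        by (intro mult_left_mono) auto
      also have "\<dots> \<le> x"
        using assms mult_div_mod_eq [of "int N" x] pos_mod_sign [of "int N" x] by linarith
      finally show False using 2 by simp
    qed
    ultimately
    show ?case using assms by auto
  next
    case (3 z)
    then show ?case using assms by (auto simp: split: prod.splits)
  next
    case (4 z)
    then obtain a t where z: "z = (a, t)" "0 \<le> a" "a < int N" "0 \<le> t" "t < int M"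
      by auto
    have "a + int N * t < int N * (t + 1)"
      using z by (simp add: distrib_left)
    also have "\<dots> \<le> int N * int M"
      using z by (intro mult_left_mono) auto
    finally show ?case using z by simp
  next
    case (5 x)
    then show ?case by simp
  qed
  then show ?thesis by (simp add: sum.cartesian_product)
qed

lemma sum_e_mod:
  assumes "N > 0"
  shows "(\<Sum>t\<in>{0..<int N}. e_mod N (x * t)) = (if int N dvd x then of_nat N else 0)"
proof (cases "int N dvd x")
  case True
  then have "e_mod N (x * t) = 1" for t
    using assms by (simp add: e_mod_eq_1_iff)
  then show ?thesis using True by simp
next
  case False
  let ?S = "\<Sum>t\<in>{0..<int N}. e_mod N (x * t)"
  have "periodic_mod N (\<lambda>t. e_mod N (x * t))"
    by (auto simp: periodic_mod_def intro!: e_mod_cong cong_scalar_left)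
  from sum_residues_affine [OF this assms, of 1 1]
  have "?S = (\<Sum>t\<in>{0..<int N}. e_mod N (x * (t + 1)))"
    by simp
  also have "\<dots> = e_mod N x * ?S"
    by (simp add: distrib_left e_mod_add sum_distrib_left mult_ac)
  finally have "(1 - e_mod N x) * ?S = 0"
    by (simp add: algebra_simps)
  moreover have "e_mod N x \<noteq> 1"
    using False assms by (simp add: e_mod_eq_1_iff)
  ultimately show ?thesis using False by simp
qed

text \<open>The value at 1 determines the character and is an \<open>N\<close>-th root of unity.\<close>

lemma additive_character_eq:
  fixes psi :: "int \<Rightarrow> complex"
  assumes "N > 0" and per: "periodic_mod N psi" and psi0: "psi 0 = 1"
    and add: "\<And>s t. psi (s + t) = psi s * psi t"
  obtains b where "\<And>t. psi t = e_mod N (b * t)"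
proof -
  have pow: "psi (int k) = psi 1 ^ k" for k
    by (induction k) (simp_all add: psi0 add)
  have "psi 1 ^ N = 1"
    using pow [of N] periodic_modD [OF per, of "int N" 0] by (simp add: psi0 cong_def)
  then obtain b where b: "psi 1 = exp (2 * of_real pi * \<i> * of_nat b / of_nat N)"
    using complex_roots_unity [of N] \<open>N > 0\<close> by auto
  then have b': "psi 1 = e_mod N (int b)"
    by (simp add: e_mod_def)
  have "psi t = e_mod N (int b * t)" for t
  proof -
    have "psi t = psi (int (nat (t mod int N)))"
      using \<open>N > 0\<close> by (intro periodic_modD [OF per]) (auto simp: cong_def)
    also have "\<dots> = e_mod N (int b * (t mod int N))"
      using \<open>N > 0\<close> by (simp only: pow b' e_mod_mult_nat [symmetric]) simp
    also have "\<dots> = e_mod N (int b * t)"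
      by (intro e_mod_cong cong_scalar_left) (simp add: cong_def)
    finally show ?thesis .
  qed
  then show ?thesis using that by blast
qed

section \<open>The sign of the quadratic Gauss sum\<close>

text \<open>Gaussian binomial coefficients, defined by one of their two Pascal rules so that \<open>q\<close> may be
  any ring element: a quotient of products of \<open>1 - q^i\<close> could not be evaluated at a
  root of unity.\<close>

fun qbinom :: "'a::comm_ring_1 \<Rightarrow> nat \<Rightarrow> nat \<Rightarrow> 'a" where
  "qbinom q n 0 = 1"
| "qbinom q 0 (Suc k) = 0"
| "qbinom q (Suc n) (Suc k) = qbinom q n k + q ^ Suc k * qbinom q n (Suc k)"

lemma qbinom_eq_0: "n < k \<Longrightarrow> qbinom q n k = 0"
  by (induction q n k rule: qbinom.induct) auto

text \<open>The division-free form of the product formula, which replaces it in what follows.\<close>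

lemma qbinom_step:
  "k \<le> n \<Longrightarrow> (1 - q ^ Suc k) * qbinom q n (Suc k) = (1 - q ^ (n - k)) * qbinom q n k"
proof (induction n arbitrary: k)
  case 0
  then show ?case by simp
next
  case (Suc n)
  show ?case
  proof (cases k)
    case 0
    have "(1 - q) * qbinom q n (Suc 0) = 1 - q ^ n"
      using Suc.IH [of 0] by simp
    moreover have "(1 - q) * (1 + q * qbinom q n (Suc 0)) = (1 - q) + q * ((1 - q) * qbinom q n (Suc 0))"
      by (simp add: algebra_simps)
    ultimately have "(1 - q) * (1 + q * qbinom q n (Suc 0)) = (1 - q) + q * (1 - q ^ n)"
      by simp
    then show ?thesis
      using 0 by (simp add: algebra_simps)
  next
    case k: (Suc k')
    show ?thesis
    proof (cases "k = Suc n")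
      case True
      then show ?thesis by (simp add: qbinom_eq_0)
    next
      case False
      then have "k \<le> n" "k' \<le> n" using Suc.prems k by auto
      let ?A = "qbinom q n k"
      have 1: "(1 - q ^ Suc k) * qbinom q n (Suc k) = (1 - q ^ (n - k)) * ?A"
        using Suc.IH \<open>k \<le> n\<close> .
      have 2: "(1 - q ^ (n - k')) * qbinom q n k' = (1 - q ^ k) * ?A"
        using Suc.IH [OF \<open>k' \<le> n\<close>] k by simp
      have e1: "q ^ Suc n = q ^ Suc k * q ^ (n - k)"
        using \<open>k \<le> n\<close> by (simp only: power_add [symmetric]) simp
      have e2: "q ^ Suc n = q ^ k * q ^ (n - k')"
        using \<open>k' \<le> n\<close> k by (simp flip: power_add power_Suc)
      have "(1 - q ^ Suc k) * qbinom q (Suc n) (Suc k)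
          = (1 - q ^ Suc k) * ?A + q ^ Suc k * ((1 - q ^ Suc k) * qbinom q n (Suc k))"
        by (simp add: algebra_simps)
      also have "\<dots> = (1 - q ^ Suc n) * ?A"
        unfolding 1 e1 by (simp add: algebra_simps)
      also have "\<dots> = (1 - q ^ (n - k')) * qbinom q n k' + q ^ k * (1 - q ^ (n - k')) * ?A"
        unfolding 2 e2 by (simp add: algebra_simps)
      also have "\<dots> = (1 - q ^ (Suc n - k)) * qbinom q (Suc n) k"
        using k by (simp add: algebra_simps)
      finally show ?thesis .
    qed
  qed
qed

lemma qbinom_absorb:
  assumes "k \<le> n"
  shows "(1 - q ^ Suc k) * qbinom q (Suc n) (Suc k) = (1 - q ^ Suc n) * qbinom q n k"
proof -
  have e1: "q ^ Suc n = q ^ Suc k * q ^ (n - k)"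
    using \<open>k \<le> n\<close> by (simp only: power_add [symmetric]) simp
  have "(1 - q ^ Suc k) * qbinom q (Suc n) (Suc k)
      = (1 - q ^ Suc k) * qbinom q n k + q ^ Suc k * ((1 - q ^ Suc k) * qbinom q n (Suc k))"
    by (simp add: algebra_simps)
  also have "\<dots> = (1 - q ^ Suc n) * qbinom q n k"
    unfolding qbinom_step [OF assms] e1 by (simp add: algebra_simps)
  finally show ?thesis .
qed

text \<open>One application of the Pascal rule and the telescoping signs leave
  \<open>1 - q^(k+1)\<close> in front of every coefficient, and absorption trades this for the constant
  factor \<open>1 - q^(n+1)\<close>.\<close>

lemma gauss_alternating_sum_Suc_Suc:
  "(\<Sum>k\<le>Suc (Suc n). (-1) ^ k * qbinom q (Suc (Suc n)) k)
     = (1 - q ^ Suc n) * (\<Sum>k\<le>n. (-1) ^ k * qbinom q n k)"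
proof -
  let ?b = "qbinom q (Suc n)"
  have A: "(\<Sum>k\<le>Suc n. (-1) ^ k * ?b k) = 1 - (\<Sum>k\<le>n. (-1) ^ k * ?b (Suc k))"
    by (subst sum.atMost_Suc_shift) (simp add: sum_negf)
  have B: "(\<Sum>k\<le>Suc n. (-1) ^ k * (q ^ Suc k * ?b (Suc k)))
      = (\<Sum>k\<le>n. (-1) ^ k * (q ^ Suc k * ?b (Suc k)))"
    by (subst sum.atMost_Suc) (simp add: qbinom_eq_0 del: qbinom.simps)
  have "(\<Sum>k\<le>Suc (Suc n). (-1) ^ k * qbinom q (Suc (Suc n)) k)
      = 1 - (\<Sum>k\<le>Suc n. (-1) ^ k * (?b k + q ^ Suc k * ?b (Suc k)))"
    by (subst sum.atMost_Suc_shift) (simp add: sum_negf)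
  also have "\<dots> = 1 - (\<Sum>k\<le>Suc n. (-1) ^ k * ?b k)
      - (\<Sum>k\<le>Suc n. (-1) ^ k * (q ^ Suc k * ?b (Suc k)))"
    by (simp only: distrib_left sum.distrib diff_diff_eq)
  also have "\<dots> = (\<Sum>k\<le>n. (-1) ^ k * ((1 - q ^ Suc k) * ?b (Suc k)))"
    unfolding A B by (simp add: sum_subtractf algebra_simps del: qbinom.simps)
  also have "\<dots> = (\<Sum>k\<le>n. (-1) ^ k * ((1 - q ^ Suc n) * qbinom q n k))"
    by (intro sum.cong refl arg_cong2 [where f = "(*)"] qbinom_absorb) simp
  finally show ?thesis
    by (simp add: sum_distrib_left mult_ac)
qed

lemma gauss_alternating_sum:
  "(\<Sum>k\<le>2 * M. (-1) ^ k * qbinom q (2 * M) k) = (\<Prod>i<M. 1 - q ^ (2 * i + 1))"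
proof (induction M)
  case (Suc M)
  then show ?case
    using gauss_alternating_sum_Suc_Suc [of q "2 * M"]
    by (simp add: mult.commute)
qed simp

text \<open>For \<open>q\<close> of exact order \<open>n + 1\<close> each ratio \<open>(1 - q^(n-k)) / (1 - q^(k+1))\<close> collapses to
  \<open>- q^(-(k+1))\<close>, so the coefficient is a signed power of \<open>q\<close> with a triangular exponent. A square
  root \<open>z\<close> of \<open>q\<close> avoids the halves in \<open>k * (k + 1) / 2\<close>.\<close>

lemma qbinom_root_of_unity:
  fixes z :: "'a::idom"
  assumes z: "(z\<^sup>2) ^ Suc n = 1" and prim: "\<And>i. 0 < i \<Longrightarrow> i \<le> n \<Longrightarrow> (z\<^sup>2) ^ i \<noteq> 1"
  shows "k \<le> n \<Longrightarrow> qbinom (z\<^sup>2) n k * z ^ (k * (k + 1)) = (-1) ^ k"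
proof (induction k)
  case (Suc k)
  let ?q = "z\<^sup>2"
  have "?q ^ Suc k * ?q ^ (n - k) = 1"
    using z Suc.prems by (simp only: power_add [symmetric]) simp
  moreover have "(1 - ?q ^ Suc k) * qbinom ?q n (Suc k) * ?q ^ Suc k
      = (?q ^ Suc k - ?q ^ Suc k * ?q ^ (n - k)) * qbinom ?q n k"
    using qbinom_step [of k n ?q] Suc.prems by (simp only: left_diff_distrib right_diff_distrib mult_1 mult_1_right mult_ac)
  ultimately have eq: "(1 - ?q ^ Suc k) * qbinom ?q n (Suc k) * ?q ^ Suc k = (?q ^ Suc k - 1) * qbinom ?q n k"
    by (simp only:)
  have "(1 - ?q ^ Suc k) * (qbinom ?q n (Suc k) * ?q ^ Suc k + qbinom ?q n k)
      = (1 - ?q ^ Suc k) * qbinom ?q n (Suc k) * ?q ^ Suc k + (1 - ?q ^ Suc k) * qbinom ?q n k"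
    by (simp only: distrib_left mult.assoc)
  also have "\<dots> = 0"
    unfolding eq by (simp only: left_diff_distrib) simp
  finally have "(1 - ?q ^ Suc k) * (qbinom ?q n (Suc k) * ?q ^ Suc k + qbinom ?q n k) = 0" .
  moreover have "1 - ?q ^ Suc k \<noteq> 0"
    using prim [of "Suc k"] Suc.prems by auto
  ultimately have *: "qbinom ?q n (Suc k) * ?q ^ Suc k = - qbinom ?q n k"
    by (simp add: eq_neg_iff_add_eq_0)
  have "z ^ (Suc k * (Suc k + 1)) = ?q ^ Suc k * z ^ (k * (k + 1))"
  proof -
    have "Suc k * (Suc k + 1) = 2 * Suc k + k * (k + 1)"
      by (simp add: algebra_simps)
    then show ?thesis
      by (simp only: power_add power_mult)
  qed
  then have "qbinom ?q n (Suc k) * z ^ (Suc k * (Suc k + 1))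
      = (qbinom ?q n (Suc k) * ?q ^ Suc k) * z ^ (k * (k + 1))"
    by (simp only: mult.assoc)
  also have "\<dots> = - (qbinom ?q n k * z ^ (k * (k + 1)))"
    unfolding * by simp
  also have "\<dots> = (-1) ^ Suc k"
    using Suc by simp
  finally show ?case .
qed simp

definition quadratic_gauss_sum :: "nat \<Rightarrow> int \<Rightarrow> complex" where
  "quadratic_gauss_sum N a = (\<Sum>t\<in>{0..<int N}. e_mod N (a * t\<^sup>2))"

lemma periodic_mod_quadratic: "periodic_mod N (\<lambda>t. e_mod N (a * t\<^sup>2))"
  by (auto simp: periodic_mod_def intro!: e_mod_cong cong_scalar_left cong_pow)

text \<open>In \<open>\<Sum>s t. e ((s\<^sup>2 - t\<^sup>2) / N)\<close> put \<open>s = u + t\<close>: the exponent becomes linear in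
  \<open>t\<close>, and since 2 is invertible only \<open>u = 0\<close> contributes.\<close>

lemma norm_quadratic_gauss_sum:
  assumes "odd N"
  shows "norm (quadratic_gauss_sum N 1) = sqrt N"
proof -
  let ?G = "quadratic_gauss_sum N 1"
  let ?I = "{0..<int N}"
  have "N > 0" using assms by (rule odd_pos)
  have "?G * cnj ?G = (\<Sum>s\<in>?I. \<Sum>t\<in>?I. e_mod N (s\<^sup>2 - t\<^sup>2))"
    by (simp add: quadratic_gauss_sum_def sum_product cnj_e_mod e_mod_diff e_mod_minus divide_inverse)
  also have "\<dots> = (\<Sum>t\<in>?I. \<Sum>s\<in>?I. e_mod N (s\<^sup>2 - t\<^sup>2))"
    by (rule sum.swap)
  also have "\<dots> = (\<Sum>t\<in>?I. \<Sum>u\<in>?I. e_mod N ((1 * u + t)\<^sup>2 - t\<^sup>2))"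
  proof (rule sum.cong [OF refl])
    fix t
    have "periodic_mod N (\<lambda>s. e_mod N (s\<^sup>2 - t\<^sup>2))"
      by (auto simp: periodic_mod_def intro!: e_mod_cong cong_diff cong_pow)
    from sum_residues_affine [OF this \<open>N > 0\<close>, of 1 t]
    show "(\<Sum>s\<in>?I. e_mod N (s\<^sup>2 - t\<^sup>2)) = (\<Sum>u\<in>?I. e_mod N ((1 * u + t)\<^sup>2 - t\<^sup>2))"
      by simp
  qed
  also have "\<dots> = (\<Sum>u\<in>?I. \<Sum>t\<in>?I. e_mod N (u\<^sup>2) * e_mod N ((2 * u) * t))"
    by (subst sum.swap) (simp add: e_mod_add [symmetric] power2_eq_square algebra_simps)
  also have "\<dots> = (\<Sum>u\<in>?I. if u = 0 then of_nat N else 0)"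
  proof (rule sum.cong [OF refl])
    fix u assume u: "u \<in> ?I"
    have "coprime (int N) 2"
      using assms by simp
    then have "int N dvd 2 * u \<longleftrightarrow> int N dvd u"
      using coprime_dvd_mult_right_iff by blast
    also have "\<dots> \<longleftrightarrow> u = 0"
      using u zdvd_not_zless [of u "int N"] by fastforce
    finally show "(\<Sum>t\<in>?I. e_mod N (u\<^sup>2) * e_mod N ((2 * u) * t)) = (if u = 0 then of_nat N else 0)"
      using sum_e_mod [OF \<open>N > 0\<close>, of "2 * u"] by (simp flip: sum_distrib_left)
  qed
  also have "\<dots> = of_nat N"
    using \<open>N > 0\<close> by simp
  finally have "complex_of_real ((norm ?G)\<^sup>2) = of_real (real N)"
    by (simp only: complex_norm_square of_real_of_nat_eq)
  then have "(norm ?G)\<^sup>2 = real N"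
    by (simp only: of_real_eq_iff)
  then show ?thesis
    by (simp add: real_sqrt_unique)
qed

text \<open>Completing the square by the shift \<open>M + 1\<close>, the inverse of 2 modulo \<open>N\<close>, turns the exponents
  into \<open>t * (t + 1)\<close>; up to sign these powers are the
  \<open>q\<close>-binomial coefficients at \<open>q = e (- 2 / N)\<close>, and Gauss' alternating sum evaluates them.
  Each factor \<open>1 - q^j\<close> is \<open>e (- j / N)\<close> times \<open>2 * \<i> * sin (2 * pi * j / N)\<close>, and the phases cancel because
  \<open>(M + 1)\<^sup>2 - M\<^sup>2 = N\<close>.\<close>

lemma quadratic_gauss_sum_eq_prod_sin:
  fixes M :: nat
  defines "N \<equiv> 2 * M + 1"
  shows "quadratic_gauss_sum N 1 = (\<Prod>i<M. 2 * \<i> * of_real (sin (2 * pi * real (2 * i + 1) / real N)))"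
proof -
  let ?I = "{0..<int N}"
  have "N > 0" by (simp add: N_def)
  let ?z = "e_mod N (-1)"
  have pw: "?z ^ k = e_mod N (- int k)" for k
    using e_mod_mult_nat [of N "-1" k] by simp
  have zk: "(?z\<^sup>2) ^ k = e_mod N (- 2 * int k)" for k
    unfolding power_mult [symmetric] by (subst pw) simp
  have z1: "(?z\<^sup>2) ^ Suc (2 * M) = 1"
  proof -
    have "- 2 * int (Suc (2 * M)) = int N * (- 2)"
      by (simp add: N_def)
    then show ?thesis
      unfolding zk using \<open>N > 0\<close> by (simp only: e_mod_eq_1_iff dvd_triv_left)
  qed
  have prim: "(?z\<^sup>2) ^ i \<noteq> 1" if "0 < i" "i \<le> 2 * M" for i
  proof
    assume "(?z\<^sup>2) ^ i = 1"
    then have "int N dvd 2 * int i"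
      using \<open>N > 0\<close> by (simp add: zk e_mod_eq_1_iff)
    moreover have "coprime (int N) 2"
      by (simp add: N_def)
    ultimately have "int N dvd int i"
      using coprime_dvd_mult_right_iff by blast
    then show False
      using that zdvd_imp_le [of "int N" "int i"] by (simp add: N_def)
  qed
  have "quadratic_gauss_sum N 1 = (\<Sum>t\<in>?I. e_mod N ((1 * t + (int M + 1))\<^sup>2))"
    using sum_residues_affine [OF periodic_mod_quadratic [of N 1] \<open>N > 0\<close>, of 1 "int M + 1"]
    by (simp add: quadratic_gauss_sum_def)
  also have "\<dots> = (\<Sum>t\<in>?I. e_mod N ((int M + 1)\<^sup>2) * e_mod N (t * (t + 1)))"
  proof (rule sum.cong [OF refl])
    fix t
    have "(1 * t + (int M + 1))\<^sup>2 = (int M + 1)\<^sup>2 + t * (t + 1) + int N * t"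
      by (simp add: N_def power2_eq_square algebra_simps)
    then have "[(1 * t + (int M + 1))\<^sup>2 = (int M + 1)\<^sup>2 + t * (t + 1)] (mod int N)"
      by (simp add: cong_def)
    then show "e_mod N ((1 * t + (int M + 1))\<^sup>2) = e_mod N ((int M + 1)\<^sup>2) * e_mod N (t * (t + 1))"
      using e_mod_cong e_mod_add by metis
  qed
  also have "\<dots> = e_mod N ((int M + 1)\<^sup>2) * (\<Sum>t\<in>?I. e_mod N (t * (t + 1)))"
    by (simp add: sum_distrib_left)
  also have "(\<Sum>t\<in>?I. e_mod N (t * (t + 1))) = (\<Sum>k\<le>2 * M. e_mod N (int k * (int k + 1)))"
    by (rule sum.reindex_bij_witness [of _ int nat]) (auto simp: N_def)
  also have "\<dots> = (\<Sum>k\<le>2 * M. (-1) ^ k * qbinom (?z\<^sup>2) (2 * M) k)"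
  proof (rule sum.cong [OF refl])
    fix k assume "k \<in> {..2 * M}"
    then have "qbinom (?z\<^sup>2) (2 * M) k * ?z ^ (k * (k + 1)) = (-1) ^ k"
      by (intro qbinom_root_of_unity z1 prim) auto
    then have "qbinom (?z\<^sup>2) (2 * M) k * (?z ^ (k * (k + 1)) * e_mod N (int k * (int k + 1)))
        = (-1) ^ k * e_mod N (int k * (int k + 1))"
      by (simp only: mult.assoc [symmetric])
    moreover have "?z ^ (k * (k + 1)) * e_mod N (int k * (int k + 1)) = 1"
      unfolding pw by (simp add: algebra_simps flip: e_mod_add)
    ultimately have "qbinom (?z\<^sup>2) (2 * M) k = (-1) ^ k * e_mod N (int k * (int k + 1))"
      by (simp only: mult_1_right)
    then have "(-1) ^ k * qbinom (?z\<^sup>2) (2 * M) k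
        = ((-1) ^ k * (-1) ^ k) * e_mod N (int k * (int k + 1))"
      by (simp only: mult.assoc)
    then show "e_mod N (int k * (int k + 1)) = (-1) ^ k * qbinom (?z\<^sup>2) (2 * M) k"
      by (simp flip: power_mult_distrib)
  qed
  also have "\<dots> = (\<Prod>i<M. 1 - (?z\<^sup>2) ^ (2 * i + 1))"
    by (rule gauss_alternating_sum)
  also have "\<dots> = (\<Prod>i<M. e_mod N (- int (2 * i + 1)) *
      (2 * \<i> * of_real (sin (2 * pi * real (2 * i + 1) / real N))))"
  proof (rule prod.cong [OF refl])
    fix i :: nat
    let ?j = "2 * i + 1"
    let ?w = "2 * pi * real ?j / real N"
    have ej: "e_mod N (int ?j) = exp (\<i> * of_real ?w)"
      by (simp add: e_mod_def algebra_simps)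
    have "of_real (sin ?w) = (e_mod N (int ?j) - e_mod N (- int ?j)) / (2 * \<i>)"
      unfolding e_mod_minus ej by (simp add: sin_of_real [symmetric] sin_exp_eq exp_minus)
    then have "2 * \<i> * of_real (sin ?w) = e_mod N (int ?j) - e_mod N (- int ?j)"
      by (simp add: field_simps)
    then have "e_mod N (- int ?j) * (2 * \<i> * of_real (sin ?w))
        = e_mod N (- int ?j) * e_mod N (int ?j) - e_mod N (- int ?j) * e_mod N (- int ?j)"
      by (simp only: right_diff_distrib)
    also have "\<dots> = 1 - (?z\<^sup>2) ^ ?j"
      unfolding zk by (simp flip: e_mod_add)
    finally show "1 - (?z\<^sup>2) ^ ?j = e_mod N (- int ?j) * (2 * \<i> * of_real (sin ?w))" ..
  qed
  also have "\<dots> = (\<Prod>i<M. e_mod N (- int (2 * i + 1))) *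
      (\<Prod>i<M. 2 * \<i> * of_real (sin (2 * pi * real (2 * i + 1) / real N)))"
    by (rule prod.distrib)
  also have "(\<Prod>i<M. e_mod N (- int (2 * i + 1))) = e_mod N (- (int M)\<^sup>2)"
    by (induction M) (simp_all add: power2_eq_square algebra_simps flip: e_mod_add)
  finally have "quadratic_gauss_sum N 1 = (e_mod N ((int M + 1)\<^sup>2) * e_mod N (- (int M)\<^sup>2)) *
      (\<Prod>i<M. 2 * \<i> * of_real (sin (2 * pi * real (2 * i + 1) / real N)))"
    by (simp only: mult.assoc)
  also have "e_mod N ((int M + 1)\<^sup>2) * e_mod N (- (int M)\<^sup>2) = e_mod N (int N)"
    by (simp add: power2_eq_square algebra_simps N_def flip: e_mod_add)
  also have "\<dots> = 1"
    using \<open>N > 0\<close> by (simp add: e_mod_eq_1_iff)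
  finally show ?thesis by simp
qed

text \<open>The angle \<open>2 * pi * j / N\<close> passes \<open>pi\<close> exactly when the odd number \<open>j\<close> exceeds \<open>M\<close>.\<close>

lemma sgn_prod_sin:
  fixes M :: nat
  defines "N \<equiv> 2 * M + 1"
  shows "sgn (\<Prod>i<M. 2 * sin (2 * pi * real (2 * i + 1) / real N)) = (-1) ^ (M div 2)"
proof -
  have sgn_prod: "sgn (\<Prod>i<K. f i) = (\<Prod>i<K. sgn (f i))" for f :: "nat \<Rightarrow> real" and K
    by (induction K) (simp_all add: sgn_mult)
  have "sgn (\<Prod>i<M. 2 * sin (2 * pi * real (2 * i + 1) / real N))
      = (\<Prod>i<M. sgn (2 * sin (2 * pi * real (2 * i + 1) / real N)))"
    by (rule sgn_prod)
  also have "\<dots> = (\<Prod>i<M. if 2 * i + 1 \<le> M then 1 else -1)"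
  proof (rule prod.cong [OF refl])
    fix i assume i: "i \<in> {..<M}"
    let ?w = "2 * pi * real (2 * i + 1) / real N"
    show "sgn (2 * sin ?w) = (if 2 * i + 1 \<le> M then 1 else -1)"
    proof (cases "2 * i + 1 \<le> M")
      case True
      have "pi * real (2 * (2 * i + 1)) < pi * real N"
        using True by (intro mult_strict_left_mono) (auto simp: N_def)
      then have "?w < pi"
        by (simp add: N_def field_simps)
      moreover have "0 < ?w"
        by (simp add: N_def)
      ultimately show ?thesis
        using True sin_gt_zero [of ?w] by (simp add: sgn_mult)
    next
      case False
      have "pi * real (2 * (2 * i + 1)) > pi * real N"
        using False by (intro mult_strict_left_mono) (auto simp: N_def)
      then have "?w > pi"
        by (simp add: N_def field_simps)
      moreover have "pi * real (2 * (2 * i + 1)) < pi * real (2 * N)"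
        using i by (intro mult_strict_left_mono) (auto simp: N_def)
      then have "?w < 2 * pi"
        by (simp add: N_def field_simps)
      ultimately show ?thesis
        using False sin_lt_zero [of ?w] by (simp add: sgn_mult)
    qed
  qed
  also have "\<dots> = (-1) ^ card {i \<in> {..<M}. \<not> 2 * i + 1 \<le> M}"
    by (simp add: prod.If_cases Int_def)
  also have "{i \<in> {..<M}. \<not> 2 * i + 1 \<le> M} = {M - M div 2..<M}"
    by auto
  finally show ?thesis by simp
qed

text \<open>The modulus comes from \<open>norm_quadratic_gauss_sum\<close> and the argument from the sine product.\<close>

theorem quadratic_gauss_sum_1:
  assumes "odd N"
  shows "quadratic_gauss_sum N 1 = eps N * of_real (sqrt N)"
proof -
  obtain M where N: "N = 2 * M + 1"
    using assms by (elim oddE)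
  let ?P = "\<Prod>i<M. 2 * sin (2 * pi * real (2 * i + 1) / real N)"
  have "quadratic_gauss_sum N 1 = (\<Prod>i<M. \<i> * of_real (2 * sin (2 * pi * real (2 * i + 1) / real N)))"
    using quadratic_gauss_sum_eq_prod_sin [of M] by (simp add: N mult_ac)
  then have G: "quadratic_gauss_sum N 1 = \<i> ^ M * of_real ?P"
    by (simp add: prod.distrib)
  then have "\<bar>?P\<bar> = sqrt N"
    using norm_quadratic_gauss_sum [OF assms]
    by (simp only: norm_mult norm_power norm_ii norm_of_real power_one mult_1)
  moreover have "sgn ?P = (-1) ^ (M div 2)"
    using sgn_prod_sin [of M] by (simp add: N)
  ultimately have "?P = (-1) ^ (M div 2) * sqrt N"
    by (metis sgn_mult_abs)
  then have "quadratic_gauss_sum N 1 = \<i> ^ M * (-1) ^ (M div 2) * of_real (sqrt N)"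
    unfolding G by simp
  also have "\<i> ^ M * (-1) ^ (M div 2) = eps N"
  proof (cases "even M")
    case True
    then obtain l where "M = 2 * l" by (elim evenE)
    then show ?thesis
      by (simp add: N eps_def cong_def power_mult flip: power_mult_distrib)
  next
    case False
    then obtain l where "M = 2 * l + 1" by (elim oddE)
    then show ?thesis
      by (simp add: N eps_def cong_def power_mult mod_Suc flip: power_mult_distrib)
  qed
  finally show ?thesis .
qed

lemma sum_residues_symmetric:
  fixes f :: "int \<Rightarrow> complex"
  assumes per: "periodic_mod N f" and even: "\<And>t. f (- t) = f t" and N: "N = 2 * M + 1"
  shows "(\<Sum>t\<in>{0..<int N}. f t) = f 0 + 2 * (\<Sum>t\<in>{1..int M}. f t)"
proof -
  have eq: "{0..<int N} = insert 0 ({1..int M} \<union> {int M + 1..<int N})"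
    using N by auto
  have "(\<Sum>t\<in>{0..<int N}. f t) = f 0 + ((\<Sum>t\<in>{1..int M}. f t) + (\<Sum>t\<in>{int M + 1..<int N}. f t))"
    unfolding eq by (subst sum.insert) (auto intro!: sum.union_disjoint)
  also have "(\<Sum>t\<in>{int M + 1..<int N}. f t) = (\<Sum>t\<in>{1..int M}. f (int N - t))"
    by (rule sum.reindex_bij_witness [of _ "\<lambda>t. int N - t" "\<lambda>t. int N - t"]) (use N in auto)
  also have "\<dots> = (\<Sum>t\<in>{1..int M}. f t)"
  proof (rule sum.cong [OF refl])
    fix t
    have "f (int N - t) = f (- t)"
      by (intro periodic_modD [OF per]) (simp add: cong_def)
    then show "f (int N - t) = f t"
      by (simp add: even)
  qed
  finally show ?thesis by simp
qed

lemma inj_on_scaled_squares: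
  fixes a :: int
  assumes p: "prime p" "p = 2 * M + 1" and a: "\<not> int p dvd a"
  shows "inj_on (\<lambda>t. a * t\<^sup>2 mod int p) {1..int M}"
proof (rule inj_onI)
  fix s t assume st: "s \<in> {1..int M}" "t \<in> {1..int M}" "a * s\<^sup>2 mod int p = a * t\<^sup>2 mod int p"
  have pp: "prime (int p)" using p(1) by (simp only: prime_nat_int_transfer)
  have "int p dvd a * s\<^sup>2 - a * t\<^sup>2"
    using st(3) by (simp add: mod_eq_dvd_iff)
  also have "a * s\<^sup>2 - a * t\<^sup>2 = a * ((s - t) * (s + t))"
    by (simp add: power2_eq_square algebra_simps)
  finally have "int p dvd s - t \<or> int p dvd s + t"
    using pp a by (simp add: prime_dvd_mult_iff)
  moreover have "\<not> int p dvd s + t"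
    using st p by (intro zdvd_not_zless) auto
  ultimately have "[s = t] (mod int p)"
    by (simp add: cong_iff_dvd_diff)
  then show "s = t"
    using st p by (intro cong_less_imp_eq_int [of s "int p" t]) auto
qed

text \<open>If \<open>a\<close> is a square, rescale \<open>t\<close>. Otherwise the classes \<open>t\<^sup>2\<close> and \<open>a * t\<^sup>2\<close> with
  \<open>1 \<le> t \<le> (p - 1) / 2\<close> exhaust the nonzero residues, so the sums for 1 and for \<open>a\<close> cancel.\<close>

theorem quadratic_gauss_sum_Legendre:
  assumes p: "prime p" "odd p" and a: "\<not> int p dvd a"
  shows "quadratic_gauss_sum p a = of_int (Legendre a (int p)) * quadratic_gauss_sum p 1"
proof (cases "QuadRes (int p) a")
  case True
  then obtain y where y: "[y\<^sup>2 = a] (mod int p)"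
    by (auto simp: QuadRes_def)
  have "p > 0" using p by (simp add: prime_gt_0_nat)
  have "\<not> int p dvd y"
    using a cong_dvd_iff [OF y] by (auto simp: power2_eq_square)
  then have cop: "coprime y (int p)"
    using p by (metis coprime_commute prime_imp_coprime prime_nat_int_transfer)
  have "quadratic_gauss_sum p a = (\<Sum>t\<in>{0..<int p}. e_mod p (1 * (y * t + 0)\<^sup>2))"
    unfolding quadratic_gauss_sum_def
    by (intro sum.cong e_mod_cong)
       (auto simp: power_mult_distrib intro!: cong_scalar_right cong_sym [OF y])
  also have "\<dots> = quadratic_gauss_sum p 1"
    unfolding quadratic_gauss_sum_def
    by (rule sum_residues_affine [OF periodic_mod_quadratic \<open>p > 0\<close> cop])
  finally show ?thesis
    using True a by (simp add: Legendre_def cong_0_iff)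
next
  case False
  obtain M where M: "p = 2 * M + 1"
    using p by (elim oddE)
  have "p > 0" "p > 1" "\<not> int p dvd 1"
    using p prime_gt_1_nat [of p] by auto
  define H where "H = {1..int M}"
  define S where "S = (\<lambda>t. 1 * t\<^sup>2 mod int p) ` H"
  define T where "T = (\<lambda>t. a * t\<^sup>2 mod int p) ` H"
  have inj1: "inj_on (\<lambda>t. 1 * t\<^sup>2 mod int p) H"
    unfolding H_def by (rule inj_on_scaled_squares) (use p M \<open>\<not> int p dvd 1\<close> in auto)
  have inja: "inj_on (\<lambda>t. a * t\<^sup>2 mod int p) H"
    unfolding H_def by (rule inj_on_scaled_squares) (use p M a in auto)
  have Hndvd: "\<not> int p dvd t" if "t \<in> H" for t
    using that M unfolding H_def by (intro zdvd_not_zless) auto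
  have pp: "prime (int p)" using p(1) by (simp only: prime_nat_int_transfer)
  have sub: "b * t\<^sup>2 mod int p \<in> {1..<int p}" if "t \<in> H" "\<not> int p dvd b" for b t
  proof -
    have "\<not> int p dvd b * t\<^sup>2"
      using that Hndvd [of t] pp by (auto simp: prime_dvd_mult_iff power2_eq_square)
    then have "b * t\<^sup>2 mod int p \<noteq> 0"
      by (simp add: dvd_eq_mod_eq_0)
    moreover have "0 \<le> b * t\<^sup>2 mod int p" "b * t\<^sup>2 mod int p < int p"
      using \<open>p > 0\<close> by simp_all
    ultimately show ?thesis by simp
  qed
  have ST: "S \<inter> T = {}"
  proof (rule ccontr)
    assume "S \<inter> T \<noteq> {}"
    then obtain s t where st: "s \<in> H" "t \<in> H" "1 * s\<^sup>2 mod int p = a * t\<^sup>2 mod int p"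
      unfolding S_def T_def by blast
    have "coprime t (int p)"
      using Hndvd [OF st(2)] pp by (metis coprime_commute prime_imp_coprime)
    then obtain u where u: "[t * u = 1] (mod int p)"
      using cong_solve_coprime_int by blast
    have "[(s * u)\<^sup>2 = s\<^sup>2 * u\<^sup>2] (mod int p)"
      by (simp add: power_mult_distrib)
    also have "[s\<^sup>2 * u\<^sup>2 = (a * t\<^sup>2) * u\<^sup>2] (mod int p)"
      using st(3) by (intro cong_scalar_right) (simp add: cong_def)
    also have "(a * t\<^sup>2) * u\<^sup>2 = a * (t * u)\<^sup>2"
      by (simp add: power_mult_distrib)
    also have "[a * (t * u)\<^sup>2 = a * 1\<^sup>2] (mod int p)"
      by (intro cong_scalar_left cong_pow u)
    finally have "QuadRes (int p) a"
      unfolding QuadRes_def by auto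
    with False show False ..
  qed
  have "S \<union> T = {1..<int p}"
  proof (rule card_subset_eq)
    show "S \<union> T \<subseteq> {1..<int p}"
      unfolding S_def T_def using sub a \<open>\<not> int p dvd 1\<close> by blast
    have "card (S \<union> T) = card S + card T"
      using ST by (intro card_Un_disjoint) (auto simp: S_def T_def H_def)
    also have "\<dots> = 2 * M"
      unfolding S_def T_def by (simp only: card_image [OF inj1] card_image [OF inja]) (simp add: H_def)
    finally show "card (S \<union> T) = card {1..<int p}"
      using M by simp
  qed simp
  then have "(\<Sum>x\<in>{1..<int p}. e_mod p x) = (\<Sum>x\<in>S. e_mod p x) + (\<Sum>x\<in>T. e_mod p x)"
    using ST by (metis finite_Un finite_atLeastLessThan_int sum.union_disjoint)
  also have "(\<Sum>x\<in>S. e_mod p x) = (\<Sum>t\<in>H. e_mod p (1 * t\<^sup>2))"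
    unfolding S_def by (subst sum.reindex [OF inj1]) (auto intro!: sum.cong e_mod_cong)
  also have "(\<Sum>x\<in>T. e_mod p x) = (\<Sum>t\<in>H. e_mod p (a * t\<^sup>2))"
    unfolding T_def by (subst sum.reindex [OF inja]) (auto intro!: sum.cong e_mod_cong)
  finally have *: "(\<Sum>t\<in>H. e_mod p (1 * t\<^sup>2)) + (\<Sum>t\<in>H. e_mod p (a * t\<^sup>2)) = (\<Sum>x\<in>{1..<int p}. e_mod p x)" ..
  have "{0..<int p} = insert 0 {1..<int p}"
    using \<open>p > 0\<close> by auto
  then have "(\<Sum>x\<in>{0..<int p}. e_mod p x) = 1 + (\<Sum>x\<in>{1..<int p}. e_mod p x)"
    by simp
  moreover have "(\<Sum>x\<in>{0..<int p}. e_mod p x) = 0"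
    using sum_e_mod [OF \<open>p > 0\<close>, of 1] \<open>\<not> int p dvd 1\<close> by simp
  ultimately have **: "(\<Sum>x\<in>{1..<int p}. e_mod p x) = - 1"
    by (simp add: eq_neg_iff_add_eq_0 add.commute)
  have "quadratic_gauss_sum p b = 1 + 2 * (\<Sum>t\<in>H. e_mod p (b * t\<^sup>2))" for b
    unfolding quadratic_gauss_sum_def H_def
    using sum_residues_symmetric [OF periodic_mod_quadratic [of p b] _ M] by simp
  then have "quadratic_gauss_sum p 1 + quadratic_gauss_sum p a
      = 2 + 2 * ((\<Sum>t\<in>H. e_mod p (1 * t\<^sup>2)) + (\<Sum>t\<in>H. e_mod p (a * t\<^sup>2)))"
    by (simp add: algebra_simps)
  also have "\<dots> = 0"
    unfolding * ** by simp
  finally have "quadratic_gauss_sum p a = - quadratic_gauss_sum p 1"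
    by (simp add: eq_neg_iff_add_eq_0 add.commute)
  then show ?thesis
    using False a by (simp add: Legendre_def cong_0_iff)
qed

section \<open>Reduction to the stationary points\<close>

locale prime_power_character =
  fixes p m :: nat and chi :: "int \<Rightarrow> complex"
  assumes prime: "prime p" and m: "m \<ge> 2" and character: "dirichlet_character (p ^ m) chi"
begin

lemma p_pos: "p > 0" and p_gt_1: "p > 1"
  using prime prime_gt_1_nat [of p] by auto

lemma prime_int: "prime (int p)"
  using prime by (simp only: prime_nat_int_transfer)

lemma chi_1: "chi 1 = 1" and chi_mult: "chi (x * y) = chi x * chi y"
  using character by (auto simp: dirichlet_character_def)

lemma chi_power: "chi (x ^ k) = chi x ^ k"
  by (induction k) (simp_all add: chi_1 chi_mult)

lemma periodic_chi: "periodic_mod (p ^ m) chi"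
  using character by (intro periodic_modI) (auto simp: dirichlet_character_def)

lemma chi_cong: "[x = y] (mod int p ^ m) \<Longrightarrow> chi x = chi y"
  using periodic_modD [OF periodic_chi] by simp

lemma coprime_prime_power_iff:
  assumes "k > 0"
  shows "coprime x (int p ^ k) \<longleftrightarrow> \<not> int p dvd x"
proof -
  have "coprime x (int p ^ k) \<longleftrightarrow> coprime (int p) x"
    using assms by (simp add: coprime_commute)
  also have "\<dots> \<longleftrightarrow> \<not> int p dvd x"
    using prime_imp_coprime [OF prime_int, of x] p_gt_1 by (auto simp: coprime_absorb_left)
  finally show ?thesis .
qed

lemma one_plus_not_dvd:
  assumes "k > 0"
  shows "\<not> int p dvd 1 + int p ^ k * t"
proof
  assume "int p dvd 1 + int p ^ k * t"
  moreover have "int p dvd int p ^ k * t"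
    using assms by (intro dvd_mult2 dvd_power) simp
  ultimately have "int p dvd 1"
    by (simp only: dvd_add_left_iff)
  then show False using p_gt_1 by simp
qed

lemma chi_eq_0: "int p dvd x \<Longrightarrow> chi x = 0"
  using character m coprime_prime_power_iff [of m x] by (auto simp: dirichlet_character_def)

lemma gauss_sum_residues:
  "gauss_sum chi (p ^ m) = (\<Sum>x\<in>{0..<int (p ^ m)}. chi x * e_mod (p ^ m) x)"
proof -
  have "{1..int (p ^ m)} = insert (int (p ^ m)) {1..<int (p ^ m)}"
    and "{0..<int (p ^ m)} = insert 0 {1..<int (p ^ m)}"
    using p_pos by (auto simp del: of_nat_power)
  moreover have "chi (int (p ^ m)) = 0" "chi 0 = 0"
    using m by (auto intro!: chi_eq_0)
  ultimately show ?thesis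
    by (simp add: gauss_sum_def del: of_nat_power)
qed

lemma periodic_summand: "periodic_mod (p ^ m) (\<lambda>x. chi x * e_mod (p ^ m) x)"
  using periodic_modD [OF periodic_chi] e_mod_cong
  unfolding periodic_mod_def by metis

text \<open>Replacing \<open>x\<close> by \<open>(1 + p^k * t) * x\<close> multiplies the summand by
  \<open>e ((x + b) * t / p^(m-k))\<close>. The sum over all \<open>t\<close> detects whether \<open>x\<close> is congruent to
  \<open>- b\<close>. The exponent \<open>k\<close> is left free: \<open>k = m - 1\<close> settles the imprimitive case, and
  \<open>k = n\<close> is used for primitive characters.\<close>

lemma gauss_sum_concentrated:
  assumes k: "0 < k" "k \<le> m" and b: "\<And>t. chi (1 + int p ^ k * t) = e_mod (p ^ (m - k)) (b * t)"
  shows "gauss_sum chi (p ^ m)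
    = (\<Sum>x\<in>{0..<int (p ^ m)}. if [x = - b] (mod int p ^ (m - k)) then chi x * e_mod (p ^ m) x else 0)"
proof -
  let ?I = "{0..<int (p ^ m)}" and ?J = "{0..<int (p ^ (m - k))}"
  let ?G = "gauss_sum chi (p ^ m)"
  have pos: "p ^ m > 0" "p ^ (m - k) > 0" using p_pos by auto
  have pm: "p ^ m = p ^ (m - k) * p ^ k"
    using k by (simp flip: power_add)
  have twist: "?G = (\<Sum>x\<in>?I. chi x * e_mod (p ^ m) x * e_mod (p ^ (m - k)) ((x + b) * t))" for t
  proof -
    let ?u = "1 + int p ^ k * t"
    have "coprime ?u (int (p ^ m))"
      using one_plus_not_dvd [OF k(1)] m coprime_prime_power_iff [of m] by simp
    then have "?G = (\<Sum>x\<in>?I. chi (?u * x + 0) * e_mod (p ^ m) (?u * x + 0))"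
      unfolding gauss_sum_residues
      by (intro sum_residues_affine [OF periodic_summand pos(1), symmetric])
    also have "\<dots> = (\<Sum>x\<in>?I. chi x * e_mod (p ^ m) x * e_mod (p ^ (m - k)) ((x + b) * t))"
    proof (rule sum.cong [OF refl])
      fix x
      have "e_mod (p ^ m) (?u * x) = e_mod (p ^ m) x * e_mod (p ^ m) (x * t * int (p ^ k))"
        by (simp add: algebra_simps flip: e_mod_add)
      also have "e_mod (p ^ m) (x * t * int (p ^ k)) = e_mod (p ^ (m - k)) (x * t)"
        unfolding pm using p_pos by (intro e_mod_cancel) simp
      finally have e: "e_mod (p ^ m) (?u * x) = e_mod (p ^ m) x * e_mod (p ^ (m - k)) (x * t)" .
      have "chi (?u * x) = e_mod (p ^ (m - k)) (b * t) * chi x"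
        by (simp only: chi_mult b)
      with e have "chi (?u * x) * e_mod (p ^ m) (?u * x) = chi x * e_mod (p ^ m) x *
          (e_mod (p ^ (m - k)) (x * t) * e_mod (p ^ (m - k)) (b * t))"
        by simp
      then show "chi (?u * x + 0) * e_mod (p ^ m) (?u * x + 0)
          = chi x * e_mod (p ^ m) x * e_mod (p ^ (m - k)) ((x + b) * t)"
        by (simp only: add_0_right distrib_right [of x b t] e_mod_add)
    qed
    finally show ?thesis .
  qed
  have "of_nat (p ^ (m - k)) * ?G = (\<Sum>t\<in>?J. ?G)"
    by simp
  also have "\<dots> = (\<Sum>t\<in>?J. \<Sum>x\<in>?I. chi x * e_mod (p ^ m) x * e_mod (p ^ (m - k)) ((x + b) * t))"
    by (rule sum.cong [OF refl]) (rule twist)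
  also have "\<dots> = (\<Sum>x\<in>?I. \<Sum>t\<in>?J. chi x * e_mod (p ^ m) x * e_mod (p ^ (m - k)) ((x + b) * t))"
    by (rule sum.swap)
  also have "\<dots> = (\<Sum>x\<in>?I. of_nat (p ^ (m - k)) *
      (if [x = - b] (mod int p ^ (m - k)) then chi x * e_mod (p ^ m) x else 0))"
  proof (rule sum.cong [OF refl])
    fix x
    have "[x = - b] (mod int p ^ (m - k)) \<longleftrightarrow> int (p ^ (m - k)) dvd x + b"
      by (simp add: cong_iff_dvd_diff)
    then show "(\<Sum>t\<in>?J. chi x * e_mod (p ^ m) x * e_mod (p ^ (m - k)) ((x + b) * t))
        = of_nat (p ^ (m - k)) * (if [x = - b] (mod int p ^ (m - k)) then chi x * e_mod (p ^ m) x else 0)"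
      unfolding sum_distrib_left [symmetric] sum_e_mod [OF pos(2)] by (simp add: mult_ac)
  qed
  also have "\<dots> = of_nat (p ^ (m - k)) *
      (\<Sum>x\<in>?I. if [x = - b] (mod int p ^ (m - k)) then chi x * e_mod (p ^ m) x else 0)"
    by (rule sum_distrib_left [symmetric])
  finally show ?thesis
    using p_pos by simp
qed

text \<open>Every proper divisor of \<open>p^m\<close> divides \<open>p^(m-1)\<close>, so this is the only modulus to test.\<close>

lemma not_primitive_iff:
  "\<not> primitive_character (p ^ m) chi \<longleftrightarrow> (\<forall>t. chi (1 + int p ^ (m - 1) * t) = 1)"
proof
  assume "\<not> primitive_character (p ^ m) chi"
  then obtain d where d: "d < p ^ m" "d dvd p ^ m"
      and triv: "\<And>x. coprime x (int (p ^ m)) \<Longrightarrow> [x = 1] (mod int d) \<Longrightarrow> chi x = 1"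
    using character unfolding primitive_character_def induced_modulus_def by blast
  obtain i where i: "i \<le> m" "d = p ^ i"
    using d(2) prime by (auto simp: divides_primepow_nat)
  with d(1) have "i \<le> m - 1"
    by (cases "i = m") auto
  then have dvd: "int d dvd int p ^ (m - 1)"
    using i by (simp add: le_imp_power_dvd)
  show "\<forall>t. chi (1 + int p ^ (m - 1) * t) = 1"
  proof
    fix t
    have "\<not> int p dvd 1 + int p ^ (m - 1) * t"
      using m by (intro one_plus_not_dvd) simp
    then have "coprime (1 + int p ^ (m - 1) * t) (int (p ^ m))"
      using m coprime_prime_power_iff [of m] by simp
    moreover have "[1 + int p ^ (m - 1) * t = 1] (mod int d)"
      using dvd by (simp add: cong_iff_dvd_diff)
    ultimately show "chi (1 + int p ^ (m - 1) * t) = 1"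
      by (rule triv)
  qed
next
  assume triv: "\<forall>t. chi (1 + int p ^ (m - 1) * t) = 1"
  have "induced_modulus (p ^ m) chi (p ^ (m - 1))"
    unfolding induced_modulus_def
  proof (intro conjI allI impI)
    show "p ^ (m - 1) dvd p ^ m"
      by (rule le_imp_power_dvd) simp
    fix x assume "coprime x (int (p ^ m)) \<and> [x = 1] (mod int (p ^ (m - 1)))"
    then have "int p ^ (m - 1) dvd x - 1"
      by (simp add: cong_iff_dvd_diff)
    then obtain t where "x - 1 = int p ^ (m - 1) * t"
      by (elim dvdE)
    then have "x = 1 + int p ^ (m - 1) * t"
      by simp
    then show "chi x = 1" using triv by blast
  qed
  moreover have "p ^ (m - 1) < p ^ m"
    using m p_gt_1 by (intro power_strict_increasing) auto
  ultimately show "\<not> primitive_character (p ^ m) chi"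
    unfolding primitive_character_def by blast
qed

theorem gauss_sum_imprimitive:
  assumes "\<not> primitive_character (p ^ m) chi"
  shows "gauss_sum chi (p ^ m) = 0"
proof -
  have "chi (1 + int p ^ (m - 1) * t) = e_mod (p ^ (m - (m - 1))) (0 * t)" for t
    using assms not_primitive_iff by simp
  then have "gauss_sum chi (p ^ m) = (\<Sum>x\<in>{0..<int (p ^ m)}.
      if [x = - 0] (mod int p ^ (m - (m - 1))) then chi x * e_mod (p ^ m) x else 0)"
    by (intro gauss_sum_concentrated) (use m in auto)
  also have "\<dots> = 0"
    by (intro sum.neutral) (use m in \<open>auto simp: cong_0_iff chi_eq_0\<close>)
  finally show ?thesis .
qed

text \<open>The exponent is split as evenly as possible: \<open>2 * n \<ge> m\<close> makes
  \<open>t \<mapsto> chi (1 + p^n * t)\<close> additive, and \<open>p^h\<close> is the precision to which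
  the averaging argument locates the terms that survive.\<close>

definition h :: nat where "h = m div 2"
definition n :: nat where "n = m - m div 2"

lemma h_plus_n: "h + n = m" and h_pos: "h > 0" and n_pos: "n > 0" and h_le_n: "h \<le> n"
  and m_diff_n: "m - n = h"
  using m by (auto simp: h_def n_def)

text \<open>The product \<open>(1 + p^n * s) * (1 + p^n * t)\<close> differs from \<open>1 + p^n * (s + t)\<close> by a
  multiple of \<open>p^(2*n)\<close>.\<close>

lemma chi_one_plus_exists:
  obtains b where "\<And>t. chi (1 + int p ^ n * t) = e_mod (p ^ h) (b * t)"
proof (rule additive_character_eq [of "p ^ h" "\<lambda>t. chi (1 + int p ^ n * t)"])
  have pm: "int p ^ m = int p ^ n * int p ^ h"
    using h_plus_n by (simp add: add.commute flip: power_add)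
  show "periodic_mod (p ^ h) (\<lambda>t. chi (1 + int p ^ n * t))"
    unfolding periodic_mod_def
    by (auto intro!: chi_cong cong_add cong_cmult_leftI simp: pm)
  fix s t
  have "int p ^ m dvd int p ^ (n + n)"
    using h_plus_n h_le_n by (intro le_imp_power_dvd) simp
  then have "int p ^ m dvd int p ^ (n + n) * (s * t)"
    by (rule dvd_mult2)
  moreover have "(1 + int p ^ n * s) * (1 + int p ^ n * t) - (1 + int p ^ n * (s + t)) = int p ^ (n + n) * (s * t)"
    by (simp add: algebra_simps power_add)
  ultimately have "[(1 + int p ^ n * s) * (1 + int p ^ n * t) = 1 + int p ^ n * (s + t)] (mod int p ^ m)"
    by (simp only: cong_iff_dvd_diff)
  then show "chi (1 + int p ^ n * (s + t)) = chi (1 + int p ^ n * s) * chi (1 + int p ^ n * t)"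
    using chi_cong chi_mult by metis
qed (use p_pos chi_1 in auto)

end

locale primitive_prime_power_character = prime_power_character +
  fixes b :: int
  assumes primitive: "primitive_character (p ^ m) chi"
    and chi_one_plus: "\<And>t. chi (1 + int p ^ n * t) = e_mod (p ^ h) (b * t)"
begin

text \<open>Otherwise \<open>chi\<close> would be trivial on \<open>1 + p^(m-1) * t\<close>, the last layer of the unit group.\<close>

lemma b_not_dvd: "\<not> int p dvd b"
proof
  assume "int p dvd b"
  then obtain b' where b': "b = int p * b'" by (elim dvdE)
  have "chi (1 + int p ^ (m - 1) * t) = 1" for t
  proof -
    have "m - 1 = n + (h - 1)" using h_plus_n h_pos by simp
    then have "chi (1 + int p ^ (m - 1) * t) = chi (1 + int p ^ n * (int p ^ (h - 1) * t))"
      by (simp add: power_add mult_ac)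
    also have "\<dots> = e_mod (p ^ h) (b * (int p ^ (h - 1) * t))"
      by (rule chi_one_plus)
    also have "b * (int p ^ (h - 1) * t) = int (p ^ h) * (b' * t)"
      using b' h_pos by (cases h) auto
    also have "e_mod (p ^ h) \<dots> = 1"
      using p_pos by (simp add: e_mod_eq_1_iff)
    finally show ?thesis .
  qed
  with primitive not_primitive_iff show False by blast
qed

text \<open>The ratio of the summand at \<open>x0 * (1 + p^h * t)\<close> to the summand at \<open>x0\<close>.\<close>

definition local_factor :: "int \<Rightarrow> int \<Rightarrow> complex" where
  "local_factor x0 t = chi (1 + int p ^ h * t) * e_mod (p ^ n) (x0 * t)"

text \<open>Stationarity of \<open>x0\<close>: a step of \<open>p^(n-h)\<close> in \<open>t\<close> multiplies the argument of \<open>chi\<close> by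
  \<open>1 + p^n * s\<close>, and the resulting phase \<open>b * s / p^h\<close> is cancelled by the exponential.\<close>

lemma local_factor_shift:
  assumes x0: "[x0 = - b] (mod int p ^ h)"
  shows "local_factor x0 (a + int p ^ (n - h) * s) = local_factor x0 a"
proof -
  have pos: "p ^ k > 0" for k using p_pos by simp
  have pm: "int p ^ m = int p ^ h * int p ^ n"
    using h_plus_n by (simp flip: power_add)
  have nh: "p ^ n = p ^ h * p ^ (n - h)" "int p ^ n = int p ^ h * int p ^ (n - h)"
    using h_le_n by (simp_all flip: power_add)
  have "int p ^ m dvd int p ^ m * (a * s)" by simp
  also have "int p ^ m * (a * s) = (1 + int p ^ h * a) * (1 + int p ^ n * s)
      - (1 + int p ^ h * (a + int p ^ (n - h) * s))"
    by (simp add: pm nh(2) algebra_simps)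
  finally have "chi ((1 + int p ^ h * a) * (1 + int p ^ n * s)) = chi (1 + int p ^ h * (a + int p ^ (n - h) * s))"
    by (intro chi_cong) (simp only: cong_iff_dvd_diff)
  then have c: "chi (1 + int p ^ h * (a + int p ^ (n - h) * s)) = chi (1 + int p ^ h * a) * e_mod (p ^ h) (b * s)"
    by (simp add: chi_mult chi_one_plus)
  have "e_mod (p ^ n) (x0 * (a + int p ^ (n - h) * s)) = e_mod (p ^ n) (x0 * a) * e_mod (p ^ n) (x0 * s * int (p ^ (n - h)))"
    by (simp add: algebra_simps flip: e_mod_add)
  also have "e_mod (p ^ n) (x0 * s * int (p ^ (n - h))) = e_mod (p ^ h) (x0 * s)"
    unfolding nh(1) by (rule e_mod_cancel [OF pos])
  finally have d: "e_mod (p ^ n) (x0 * (a + int p ^ (n - h) * s)) = e_mod (p ^ n) (x0 * a) * e_mod (p ^ h) (x0 * s)" .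
  have "int (p ^ h) dvd (b + x0) * s"
    using x0 by (simp add: cong_iff_dvd_diff add.commute)
  then have "e_mod (p ^ h) (b * s) * e_mod (p ^ h) (x0 * s) = 1"
    using pos [of h] by (simp add: e_mod_eq_1_iff distrib_right flip: e_mod_add)
  then show ?thesis
    unfolding local_factor_def c d by (simp add: mult_ac)
qed

text \<open>The surviving residues \<open>x0 + p^h * t\<close> are rewritten as \<open>x0 * (1 + p^h * t)\<close>, which is a
  permutation of the \<open>t\<close> because \<open>x0\<close> is a unit; the local factor then has period \<open>p^(n-h)\<close>.\<close>

theorem gauss_sum_reduced:
  assumes x0: "[x0 = - b] (mod int p ^ h)"
  shows "gauss_sum chi (p ^ m) = of_nat (p ^ h) * (chi x0 * e_mod (p ^ m) x0 *
    (\<Sum>t\<in>{0..<int (p ^ (n - h))}. local_factor x0 t))"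
proof -
  have pos: "p ^ k > 0" for k using p_pos by simp
  let ?f = "\<lambda>x. chi x * e_mod (p ^ m) x"
  have pm: "p ^ m = p ^ n * p ^ h" "p ^ m = p ^ h * p ^ n" "int p ^ m = int p ^ h * int p ^ n"
    using h_plus_n by (simp_all add: mult.commute flip: power_add)
  have nh: "p ^ n = p ^ h * p ^ (n - h)" "p ^ n = p ^ (n - h) * p ^ h"
    "int p ^ n = int p ^ h * int p ^ (n - h)"
    using h_le_n by (simp_all add: mult.commute flip: power_add)
  have x0p: "\<not> int p dvd x0"
  proof -
    have "[x0 = - b] (mod int p)"
      using x0 h_pos by (rule_tac cong_dvd_modulus) (auto intro: dvd_power)
    then show ?thesis
      using b_not_dvd cong_dvd_iff [of x0 "- b" "int p"] by simp
  qed
  have "gauss_sum chi (p ^ m) = (\<Sum>x\<in>{0..<int (p ^ m)}. if [x = - b] (mod int p ^ h) then ?f x else 0)"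
    using gauss_sum_concentrated [of n b] n_pos h_plus_n chi_one_plus m_diff_n by simp
  also have "\<dots> = (\<Sum>x\<in>{0..<int (p ^ m)}. if [1 * x + x0 = - b] (mod int p ^ h) then ?f (1 * x + x0) else 0)"
  proof (rule sum_residues_affine [symmetric])
    show "periodic_mod (p ^ m) (\<lambda>x. if [x = - b] (mod int p ^ h) then ?f x else 0)"
      unfolding periodic_mod_def
    proof (intro allI impI)
      fix x y assume xy: "[x = y] (mod int (p ^ m))"
      then have "[x = y] (mod int p ^ h)"
        by (rule cong_dvd_modulus) (simp add: pm)
      then have "[x = - b] (mod int p ^ h) \<longleftrightarrow> [y = - b] (mod int p ^ h)"
        using cong_trans cong_sym by blast
      then show "(if [x = - b] (mod int p ^ h) then ?f x else 0) = (if [y = - b] (mod int p ^ h) then ?f y else 0)"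
        using periodic_modD [OF periodic_summand xy] by simp
    qed
  qed (use pos in auto)
  also have "\<dots> = (\<Sum>x\<in>{0..<int (p ^ m)}. if int p ^ h dvd x then ?f (x + x0) else 0)"
  proof (rule sum.cong [OF refl])
    fix x
    have "[1 * x + x0 = - b] (mod int p ^ h) \<longleftrightarrow> [1 * x + x0 = 0 + x0] (mod int p ^ h)"
      using x0 by (metis add_0 cong_sym cong_trans)
    also have "\<dots> \<longleftrightarrow> int p ^ h dvd x"
      by (simp add: cong_iff_dvd_diff)
    finally show "(if [1 * x + x0 = - b] (mod int p ^ h) then ?f (1 * x + x0) else 0)
        = (if int p ^ h dvd x then ?f (x + x0) else 0)" by simp
  qed
  also have "\<dots> = (\<Sum>a\<in>{0..<int (p ^ h)}. \<Sum>t\<in>{0..<int (p ^ n)}.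
      if int p ^ h dvd a + int (p ^ h) * t then ?f (a + int (p ^ h) * t + x0) else 0)"
    unfolding pm(2) by (rule sum_residues_split [OF pos])
  also have "\<dots> = (\<Sum>a\<in>{0..<int (p ^ h)}. if a = 0 then (\<Sum>t\<in>{0..<int (p ^ n)}. ?f (x0 + int p ^ h * t)) else 0)"
  proof (rule sum.cong [OF refl])
    fix a assume a: "a \<in> {0..<int (p ^ h)}"
    have "int p ^ h dvd a + int (p ^ h) * t \<longleftrightarrow> int p ^ h dvd a" for t
      using dvd_add_times_triv_right_iff [of "int p ^ h" a t] by (simp add: mult.commute)
    moreover have "int p ^ h dvd a \<longleftrightarrow> a = 0"
      using a zdvd_not_zless [of a "int p ^ h"] by fastforce
    ultimately show "(\<Sum>t\<in>{0..<int (p ^ n)}.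
      if int p ^ h dvd a + int (p ^ h) * t then ?f (a + int (p ^ h) * t + x0) else 0)
      = (if a = 0 then (\<Sum>t\<in>{0..<int (p ^ n)}. ?f (x0 + int p ^ h * t)) else 0)"
      by (simp add: add.commute)
  qed
  also have "\<dots> = (\<Sum>t\<in>{0..<int (p ^ n)}. ?f (x0 + int p ^ h * t))"
    using pos [of h] by (subst sum.delta) auto
  also have "\<dots> = (\<Sum>t\<in>{0..<int (p ^ n)}. ?f (x0 + int p ^ h * (x0 * t + 0)))"
  proof (rule sum_residues_affine [symmetric])
    show "periodic_mod (p ^ n) (\<lambda>t. ?f (x0 + int p ^ h * t))"
      unfolding periodic_mod_def
      by (intro allI impI periodic_modD [OF periodic_summand])
         (auto simp: pm(3) intro!: cong_add cong_cmult_leftI)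
    show "coprime x0 (int (p ^ n))"
      using x0p n_pos coprime_prime_power_iff [of n] by simp
  qed (use pos in auto)
  also have "\<dots> = (\<Sum>t\<in>{0..<int (p ^ n)}. ?f x0 * local_factor x0 t)"
  proof (rule sum.cong [OF refl])
    fix t
    have "x0 + int p ^ h * (x0 * t + 0) = x0 * (1 + int p ^ h * t)"
      by (simp add: algebra_simps)
    moreover have "e_mod (p ^ m) (x0 + int p ^ h * (x0 * t + 0)) = e_mod (p ^ m) x0 * e_mod (p ^ m) (x0 * t * int (p ^ h))"
      by (simp add: algebra_simps flip: e_mod_add)
    moreover have "e_mod (p ^ m) (x0 * t * int (p ^ h)) = e_mod (p ^ n) (x0 * t)"
      unfolding pm(1) by (rule e_mod_cancel [OF pos])
    ultimately show "?f (x0 + int p ^ h * (x0 * t + 0)) = ?f x0 * local_factor x0 t"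
      by (simp add: local_factor_def chi_mult mult_ac)
  qed
  also have "\<dots> = ?f x0 * (\<Sum>t\<in>{0..<int (p ^ n)}. local_factor x0 t)"
    by (rule sum_distrib_left [symmetric])
  also have "(\<Sum>t\<in>{0..<int (p ^ n)}. local_factor x0 t)
      = (\<Sum>a\<in>{0..<int (p ^ (n - h))}. \<Sum>s\<in>{0..<int (p ^ h)}. local_factor x0 (a + int (p ^ (n - h)) * s))"
    unfolding nh(2) [symmetric] using sum_residues_split [OF pos, of "local_factor x0" "n - h" "p ^ h"] nh(2) by simp
  also have "\<dots> = (\<Sum>a\<in>{0..<int (p ^ (n - h))}. \<Sum>s\<in>{0..<int (p ^ h)}. local_factor x0 a)"
  proof (intro sum.cong refl)
    fix a s
    show "local_factor x0 (a + int (p ^ (n - h)) * s) = local_factor x0 a"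
      using local_factor_shift [OF x0] by simp
  qed
  also have "\<dots> = of_nat (p ^ h) * (\<Sum>t\<in>{0..<int (p ^ (n - h))}. local_factor x0 t)"
    by (simp add: sum_distrib_left)
  finally show ?thesis
    by (simp only: mult_ac)
qed

lemma gauss_sum_even_exponent:
  assumes "even m" and x0: "[x0 = - b] (mod int p ^ h)"
  shows "gauss_sum chi (p ^ m) = of_nat (p ^ h) * (chi x0 * e_mod (p ^ m) x0)"
proof -
  have "n = h" using assms(1) by (auto simp: n_def h_def elim!: evenE)
  moreover have "{0..<1::int} = {0}" by auto
  ultimately show ?thesis
    using gauss_sum_reduced [OF x0] by (simp add: local_factor_def chi_1)
qed

end

section \<open>Quotients of the powers of a primitive root\<close>

lemma cong_1_power_prime:
  fixes x :: int
  assumes "i > 0" and x: "[x = 1] (mod int p ^ i)"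
  shows "[x ^ p = 1] (mod int p ^ Suc i)"
proof -
  have "[x = 1] (mod int p)"
    using x assms(1) by (rule_tac cong_dvd_modulus) (auto intro: dvd_power)
  then have "[(\<Sum>k<p. x ^ k) = (\<Sum>k<p. 1 ^ k)] (mod int p)"
    by (intro cong_sum cong_pow)
  then have "int p dvd (\<Sum>k<p. x ^ k)"
    using cong_dvd_iff by fastforce
  moreover have "int p ^ i dvd x - 1"
    using x by (simp add: cong_iff_dvd_diff)
  ultimately have "int p ^ i * int p dvd (x - 1) * (\<Sum>k<p. x ^ k)"
    by (rule mult_dvd_mono [rotated])
  also have "(x - 1) * (\<Sum>k<p. x ^ k) = x ^ p - 1"
    by (rule power_diff_1_eq [symmetric])
  finally show ?thesis
    by (simp add: cong_iff_dvd_diff mult.commute)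
qed

text \<open>The binomial expansion up to second order. From the cubic term on, \<open>p\<close> divides
  the binomial coefficient and contributes \<open>p^(3*j+1)\<close>, except in the last term, which is only
  divisible by \<open>p^(p*j)\<close>; this gives the two bounds on \<open>e\<close>.\<close>

lemma one_plus_power_prime_cong:
  fixes R :: int
  assumes p: "prime p" "p = 2 * M + 1" and e: "e \<le> 3 * j + 1" "e \<le> p * j"
  shows "[(1 + R * int p ^ j) ^ p = 1 + int p ^ Suc j * (R + int M * int p ^ j * R\<^sup>2)] (mod int p ^ e)"
proof -
  let ?y = "R * int p ^ j"
  let ?f = "\<lambda>l. of_nat (p choose l) * ?y ^ l"
  have "M \<noteq> 0" using p by (intro notI) simp
  then have eq: "{..p} = {0, 1, 2} \<union> {3..p}"
    using p by auto
  have "(1 + ?y) ^ p = (\<Sum>l\<le>p. ?f l)"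
    using binomial_ring [of ?y 1 p] by (simp add: add.commute)
  also have "\<dots> = (\<Sum>l\<in>{0, 1, 2}. ?f l) + (\<Sum>l\<in>{3..p}. ?f l)"
    unfolding eq by (rule sum.union_disjoint) auto
  also have "[\<dots> = (\<Sum>l\<in>{0, 1, 2}. ?f l) + 0] (mod int p ^ e)"
  proof (intro cong_add cong_refl)
    have "int p ^ e dvd ?f l" if "l \<in> {3..p}" for l
    proof (cases "l = p")
      case True
      have "int p ^ e dvd int p ^ (j * p)"
        using e by (intro le_imp_power_dvd) (simp add: mult.commute)
      then show ?thesis
        using True by (simp add: power_mult_distrib power_mult)
    next
      case False
      have "e \<le> Suc (j * l)"
      proof -
        have "j * 3 \<le> j * l" using that by (intro mult_le_mono2) simp
        then show ?thesis using e(1) by linarith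
      qed
      then have "int p ^ e dvd int p ^ Suc (j * l)"
        by (rule le_imp_power_dvd)
      moreover have "p dvd p choose l"
        using False that p by (intro dvd_choose_prime) auto
      then have "int p dvd int (p choose l)"
        by simp
      then have "int p * int p ^ (j * l) dvd int (p choose l) * ?y ^ l"
        by (intro mult_dvd_mono) (simp_all add: power_mult_distrib power_mult)
      ultimately show ?thesis
        by (simp only: power_Suc) (rule dvd_trans)
    qed
    then show "[(\<Sum>l\<in>{3..p}. ?f l) = 0] (mod int p ^ e)"
      by (auto simp: cong_0_iff intro!: dvd_sum)
  qed
  also have "(\<Sum>l\<in>{0, 1, 2}. ?f l) + 0 = 1 + int p * ?y + int (p choose 2) * ?y\<^sup>2"
    by simp
  also have "p choose 2 = p * M"
    by (simp add: choose_two p)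
  also have "1 + int p * ?y + int (p * M) * ?y\<^sup>2 = 1 + int p ^ Suc j * (R + int M * int p ^ j * R\<^sup>2)"
    by (simp add: power2_eq_square algebra_simps)
  finally show ?thesis .
qed

text \<open>The sharper congruence requires precision \<open>2 * j + 2\<close> in the expansion. The bound
  \<open>2 * j + 2 \<le> p * j\<close> fails among odd primes precisely for \<open>p = 3\<close>, \<open>j = 1\<close>, where the
  last term is cubic and visible.\<close>

lemma prime_power_quotient_lift:
  fixes R R' :: int
  assumes p: "prime p" "p = 2 * M + 1" and "j > 0"
    and lift: "(1 + R * int p ^ j) ^ p = 1 + R' * int p ^ Suc j"
  shows "[R' = R] (mod int p ^ j)"
    and "\<not> (p = 3 \<and> j = 1) \<Longrightarrow> [R' = R + int M * int p ^ j * R\<^sup>2] (mod int p ^ Suc j)"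
proof -
  have "p > 0" using p by simp
  have "M \<noteq> 0" using p by (intro notI) simp
  have main: "[R' = R + int M * int p ^ j * R\<^sup>2] (mod int p ^ k)"
    if "Suc j + k \<le> 3 * j + 1" "Suc j + k \<le> p * j" for k
  proof -
    have "[1 + int p ^ Suc j * R' = 1 + int p ^ Suc j * (R + int M * int p ^ j * R\<^sup>2)] (mod int p ^ (Suc j + k))"
      using one_plus_power_prime_cong [OF p that, of R] unfolding lift by (simp only: mult.commute)
    then have "[int p ^ Suc j * R' = int p ^ Suc j * (R + int M * int p ^ j * R\<^sup>2)] (mod int p ^ Suc j * int p ^ k)"
      by (simp only: cong_add_lcancel power_add)
    then have "int p ^ Suc j * int p ^ k dvd int p ^ Suc j * (R' - (R + int M * int p ^ j * R\<^sup>2))"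
      by (simp only: cong_iff_dvd_diff right_diff_distrib)
    then show ?thesis
      using \<open>p > 0\<close> by (simp only: cong_iff_dvd_diff) simp
  qed
  have "3 * j \<le> p * j"
    using p \<open>M \<noteq> 0\<close> by (intro mult_le_mono1) auto
  then have "[R' = R + int M * int p ^ j * R\<^sup>2] (mod int p ^ j)"
    using \<open>j > 0\<close> by (intro main) linarith+
  also have "[R + int M * int p ^ j * R\<^sup>2 = R + 0] (mod int p ^ j)"
    by (intro cong_add cong_refl) (simp add: cong_0_iff)
  finally show "[R' = R] (mod int p ^ j)" by simp
  assume ne: "\<not> (p = 3 \<and> j = 1)"
  show "[R' = R + int M * int p ^ j * R\<^sup>2] (mod int p ^ Suc j)"
  proof (rule main)
    show "Suc j + Suc j \<le> p * j"
    proof (cases "p = 3")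
      case True
      then show ?thesis using ne \<open>j > 0\<close> by simp
    next
      case False
      then have "5 * j \<le> p * j"
        using p \<open>M \<noteq> 0\<close> by (intro mult_le_mono1) auto
      then show ?thesis using \<open>j > 0\<close> by linarith
    qed
  qed (use \<open>j > 0\<close> in simp)
qed

lemma euler_theorem_int:
  fixes a :: int
  assumes "coprime a (int N)" "N > 0"
  shows "[a ^ totient N = 1] (mod int N)"
proof -
  have "[int (nat (a mod int N)) = a] (mod int N)"
    using assms(2) by (simp add: cong_def)
  then have "[a ^ totient N = int (nat (a mod int N)) ^ totient N] (mod int N)"
    using cong_pow cong_sym by blast
  also have "coprime (int (nat (a mod int N))) (int N)"
    using assms by simp
  then have "coprime (nat (a mod int N)) N"
    by (simp only: coprime_int_iff)
  then have "[int (nat (a mod int N) ^ totient N) = int 1] (mod int N)"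
    using euler_theorem by (simp only: cong_int_iff)
  then have "[int (nat (a mod int N)) ^ totient N = 1] (mod int N)"
    by simp
  finally show ?thesis .
qed

text \<open>The integer \<open>R_j\<close> with \<open>a^\<phi>(p^j) = 1 + R_j * p^j\<close>; for \<open>j = 1\<close> it is the Fermat quotient.\<close>

definition euler_quotient :: "nat \<Rightarrow> int \<Rightarrow> nat \<Rightarrow> int" where
  "euler_quotient p a j = (a ^ totient (p ^ j) - 1) div int p ^ j"

lemma euler_quotient_unique:
  assumes "p > 0" "a ^ totient (p ^ j) = 1 + R * int p ^ j"
  shows "R = euler_quotient p a j"
  using assms by (simp add: euler_quotient_def)

lemma euler_quotient:
  assumes "prime p" "\<not> int p dvd a"
  shows "a ^ totient (p ^ j) = 1 + euler_quotient p a j * int p ^ j"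
proof -
  have "prime (int p)"
    using assms by (simp only: prime_nat_int_transfer)
  then have "coprime a (int (p ^ j))"
    using prime_imp_coprime [OF _ assms(2)] by (simp add: coprime_commute)
  then have "int p ^ j dvd a ^ totient (p ^ j) - 1"
    using euler_theorem_int [of a "p ^ j"] prime_gt_0_nat [OF assms(1)] by (simp add: cong_iff_dvd_diff)
  then show ?thesis
    by (simp add: euler_quotient_def)
qed

lemma totient_prime_power_add:
  assumes "prime p" "j > 0"
  shows "totient (p ^ (j + i)) = totient (p ^ j) * p ^ i"
proof -
  obtain k where "j = Suc k" using assms(2) by (cases j) auto
  then show ?thesis
    by (simp only: add_Suc totient_prime_power_Suc [OF assms(1)] power_add mult_ac)
qed

lemma euler_quotient_Suc:
  assumes "prime p" "p = 2 * M + 1" "\<not> int p dvd a" "j > 0"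
  shows "[euler_quotient p a (Suc j) = euler_quotient p a j] (mod int p ^ j)"
    and "\<not> (p = 3 \<and> j = 1) \<Longrightarrow> [euler_quotient p a (Suc j)
      = euler_quotient p a j + int M * int p ^ j * (euler_quotient p a j)\<^sup>2] (mod int p ^ Suc j)"
proof -
  have "(1 + euler_quotient p a j * int p ^ j) ^ p = 1 + euler_quotient p a (Suc j) * int p ^ Suc j"
    using totient_prime_power_add [OF assms(1,4), of 1]
    by (simp add: euler_quotient [OF assms(1,3), symmetric] power_mult del: power_Suc)
  note prime_power_quotient_lift [OF assms(1,2,4) this]
  then show "[euler_quotient p a (Suc j) = euler_quotient p a j] (mod int p ^ j)"
    and "\<not> (p = 3 \<and> j = 1) \<Longrightarrow> [euler_quotient p a (Suc j)
      = euler_quotient p a j + int M * int p ^ j * (euler_quotient p a j)\<^sup>2] (mod int p ^ Suc j)"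
    by blast+
qed

lemma euler_quotient_cong:
  assumes "prime p" "odd p" "\<not> int p dvd a" "i > 0" "i \<le> j"
  shows "[euler_quotient p a j = euler_quotient p a i] (mod int p ^ i)"
  using assms(5)
proof (induction j rule: dec_induct)
  case base
  then show ?case by simp
next
  case (step j)
  obtain M where "p = 2 * M + 1"
    using assms(2) by (elim oddE)
  then have "[euler_quotient p a (Suc j) = euler_quotient p a j] (mod int p ^ j)"
    using assms step by (intro euler_quotient_Suc) auto
  then have "[euler_quotient p a (Suc j) = euler_quotient p a j] (mod int p ^ i)"
    using step by (rule_tac cong_dvd_modulus) (auto intro: le_imp_power_dvd)
  then show ?case
    using step.IH cong_trans by blast
qed

text \<open>If \<open>p\<close> divided the first quotient, then \<open>a^(p-1)\<close> would be 1 modulo \<open>p\<^sup>2\<close>, and raising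
  to the \<open>p\<close>-th power repeatedly would make the order of \<open>a\<close> modulo \<open>p^m\<close> too small.\<close>

lemma euler_quotient_primitive_root:
  assumes p: "prime p" and m: "m \<ge> 2" and a: "primitive_root (p ^ m) a"
  shows "\<not> int p dvd a" and "\<not> int p dvd euler_quotient p a 1"
proof -
  define g where "g = nat (a mod int (p ^ m))"
  have pos: "p > 1" "p ^ m > 0" using prime_gt_1_nat [OF p] by auto
  then have g: "int g = a mod int (p ^ m)"
    by (simp add: g_def)
  have prim: "coprime (p ^ m) g" "ord (p ^ m) g = totient (p ^ m)"
    using a by (auto simp: primitive_root_def residue_primroot_def g_def)
  have "coprime (int g) (int (p ^ m))"
    using prim(1) by (simp only: coprime_int_iff coprime_commute)
  then have "coprime a (int (p ^ m))"
    using pos coprime_mod_left_iff [of "int (p ^ m)" a] unfolding g by simp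
  then have "coprime a (int p)"
    using m by simp
  then show ndvd: "\<not> int p dvd a"
    using pos by (auto simp: coprime_absorb_right)
  show "\<not> int p dvd euler_quotient p a 1"
  proof
    assume "int p dvd euler_quotient p a 1"
    then obtain r where "euler_quotient p a 1 = int p * r" by (elim dvdE)
    then have "a ^ (p - 1) = 1 + r * int p ^ 2"
      using euler_quotient [OF p ndvd, of 1] totient_prime [OF p] by (simp add: power2_eq_square mult_ac)
    then have base: "[a ^ (p - 1) = 1] (mod int p ^ 2)"
      by (simp add: cong_iff_dvd_diff)
    have "[a ^ ((p - 1) * p ^ i) = 1] (mod int p ^ (2 + i))" for i
    proof (induction i)
      case 0
      then show ?case using base by simp
    next
      case (Suc i)
      then have "[(a ^ ((p - 1) * p ^ i)) ^ p = 1] (mod int p ^ Suc (2 + i))"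
        by (intro cong_1_power_prime) auto
      then show ?case
        by (simp only: power_mult [symmetric] mult.assoc power_Suc2 [symmetric] add_Suc_right)
    qed
    from this [of "m - 2"] have "[a ^ ((p - 1) * p ^ (m - 2)) = 1] (mod int (p ^ m))"
      by (simp only: le_add_diff_inverse [OF m] of_nat_power)
    moreover have "[int g ^ ((p - 1) * p ^ (m - 2)) = a ^ ((p - 1) * p ^ (m - 2))] (mod int (p ^ m))"
      by (intro cong_pow) (simp only: g cong_mod_left cong_refl)
    ultimately have "[int (g ^ ((p - 1) * p ^ (m - 2))) = int 1] (mod int (p ^ m))"
      using cong_trans by fastforce
    then have "[g ^ ((p - 1) * p ^ (m - 2)) = 1] (mod p ^ m)"
      by (simp only: cong_int_iff)
    then have "totient (p ^ m) dvd (p - 1) * p ^ (m - 2)"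
      by (simp only: ord_divides prim(2))
    moreover have "totient (p ^ m) = p * ((p - 1) * p ^ (m - 2))"
    proof -
      have "m - 1 = Suc (m - 2)" using m by simp
      then show ?thesis
        using m p by (simp add: totient_prime_power)
    qed
    ultimately have "p * ((p - 1) * p ^ (m - 2)) \<le> 1 * ((p - 1) * p ^ (m - 2))"
      using pos by (auto dest!: dvd_imp_le)
    then have "p \<le> 1"
      using pos by (subst (asm) mult_le_cancel2) simp
    then show False using pos by simp
  qed
qed

lemma Legendre_square_cong:
  assumes p: "prime p" and u: "\<not> int p dvd u" and v: "\<not> int p dvd v"
    and xy: "[x * u\<^sup>2 = y * v\<^sup>2] (mod int p)"
  shows "Legendre x (int p) = Legendre y (int p)"
proof -
  have pp: "prime (int p)" using p by (simp only: prime_nat_int_transfer)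
  have inv: "\<exists>w. [u * w = 1] (mod int p) \<and> \<not> int p dvd w" if "\<not> int p dvd u" for u
  proof -
    have "coprime u (int p)"
      using prime_imp_coprime [OF pp that] by (simp add: coprime_commute)
    then obtain w where w: "[u * w = 1] (mod int p)"
      using cong_solve_coprime_int by blast
    moreover have "\<not> int p dvd w"
      using cong_dvd_iff [OF w] pp by (metis dvd_mult not_prime_unit)
    ultimately show ?thesis by blast
  qed
  have dvd: "int p dvd x" if "[x * u\<^sup>2 = y * v\<^sup>2] (mod int p)" "\<not> int p dvd u" "int p dvd y" for x y u v
  proof -
    have "int p dvd x * u\<^sup>2"
      using cong_dvd_iff [OF that(1)] that(3) by simp
    then show ?thesis
      using that(2) pp prime_dvd_mult_iff prime_dvd_power by blast
  qed
  have quad: "QuadRes (int p) x"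
    if xy: "[x * u\<^sup>2 = y * v\<^sup>2] (mod int p)" and u: "\<not> int p dvd u" and y: "QuadRes (int p) y" for x y u v
  proof -
    obtain w where w: "[u * w = 1] (mod int p)"
      using inv [OF u] by blast
    obtain z where z: "[z\<^sup>2 = y] (mod int p)"
      using y by (auto simp: QuadRes_def)
    have "[(z * v * w)\<^sup>2 = z\<^sup>2 * v\<^sup>2 * w\<^sup>2] (mod int p)"
      by (simp add: power_mult_distrib)
    also have "[z\<^sup>2 * v\<^sup>2 * w\<^sup>2 = y * v\<^sup>2 * w\<^sup>2] (mod int p)"
      by (intro cong_scalar_right z)
    also have "[y * v\<^sup>2 * w\<^sup>2 = x * u\<^sup>2 * w\<^sup>2] (mod int p)"
      by (intro cong_scalar_right cong_sym [OF xy])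
    also have "x * u\<^sup>2 * w\<^sup>2 = x * (u * w)\<^sup>2"
      by (simp add: power_mult_distrib)
    also have "[x * (u * w)\<^sup>2 = x * 1\<^sup>2] (mod int p)"
      by (intro cong_scalar_left cong_pow w)
    finally show ?thesis
      unfolding QuadRes_def by auto
  qed
  have "int p dvd x \<longleftrightarrow> int p dvd y" "QuadRes (int p) x \<longleftrightarrow> QuadRes (int p) y"
    using dvd [OF xy u] dvd [OF cong_sym [OF xy] v] quad [OF xy u] quad [OF cong_sym [OF xy] v]
    by blast+
  then show ?thesis
    by (simp add: Legendre_def cong_0_iff)
qed

section \<open>Odd primes\<close>

lemma powr_half:
  assumes "x > 0"
  shows "x powr (real k / 2) = x ^ (k div 2) * (if even k then 1 else sqrt x)"
proof (cases "even k")
  case True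
  then obtain i where "k = 2 * i" by (elim evenE)
  then show ?thesis using assms by (simp add: powr_realpow)
next
  case False
  then obtain i where k: "k = 2 * i + 1" by (elim oddE)
  have "real k / 2 = real i + 1 / 2"
    by (simp add: k add_divide_distrib)
  then have "x powr (real k / 2) = x powr real i * x powr (1 / 2)"
    by (simp only: powr_add)
  then show ?thesis using assms k by (simp add: powr_realpow powr_half_sqrt)
qed

context prime_power_character
begin

text \<open>This links the exponent \<open>c\<close> of \<open>chi\<close> at the generator to its values on the layer
  \<open>1 + p^i * t\<close>.\<close>

lemma chi_euler_quotient:
  assumes a: "\<not> int p dvd a" and i: "0 < i" "i \<le> m" and c: "chi a = e_mod (totient (p ^ m)) c"
  shows "chi (1 + int p ^ i * euler_quotient p a i) = e_mod (p ^ (m - i)) c"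
proof -
  have "totient (p ^ m) = totient (p ^ (i + (m - i)))"
    using i by simp
  also have "\<dots> = p ^ (m - i) * totient (p ^ i)"
    using totient_prime_power_add [OF prime i(1), of "m - i"] by (simp only: mult.commute)
  finally have tot: "totient (p ^ m) = p ^ (m - i) * totient (p ^ i)" .
  have "chi (1 + int p ^ i * euler_quotient p a i) = chi (a ^ totient (p ^ i))"
    by (simp only: euler_quotient [OF prime a] mult.commute)
  also have "\<dots> = e_mod (totient (p ^ m)) (c * int (totient (p ^ i)))"
    by (simp only: chi_power c e_mod_mult_nat)
  also have "\<dots> = e_mod (p ^ (m - i)) c"
    unfolding tot by (rule e_mod_cancel) (use p_pos in simp)
  finally show ?thesis .
qed

end

context primitive_prime_power_character
begin

text \<open>Modulo \<open>p^(3*h)\<close>, hence modulo \<open>p^m\<close>,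
  \<open>(1 + p^h * s) * (1 + p^h * t)\<close> equals
  \<open>(1 + p^h * (s + t)) * (1 + p^(2*h) * s * t)\<close>, and \<open>chi\<close> is explicit on the last factor.\<close>

lemma local_factor_add:
  assumes "odd m"
  shows "local_factor x0 s * local_factor x0 t = local_factor x0 (s + t) * e_mod p (b * s * t)"
proof -
  have mh: "m = 2 * h + 1" and nh: "n = Suc h"
    using assms by (auto simp: h_def n_def elim!: oddE)
  obtain h' where h': "h = Suc h'" using h_pos by (cases h) auto
  let ?P = "int p ^ h"
  have "int p ^ m dvd ?P ^ 3 * (s * t * (s + t))"
  proof -
    have "int p ^ m dvd int p ^ (h * 3)"
      using mh h_pos by (intro le_imp_power_dvd) simp
    then show ?thesis by (simp add: power_mult)
  qed
  also have "?P ^ 3 * (s * t * (s + t)) =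
      (1 + ?P * (s + t)) * (1 + ?P\<^sup>2 * (s * t)) - (1 + ?P * s) * (1 + ?P * t)"
    by (simp add: algebra_simps power2_eq_square power3_eq_cube)
  finally have "chi ((1 + ?P * (s + t)) * (1 + ?P\<^sup>2 * (s * t))) = chi ((1 + ?P * s) * (1 + ?P * t))"
    by (intro chi_cong) (simp only: cong_iff_dvd_diff)
  moreover have "chi (1 + ?P\<^sup>2 * (s * t)) = e_mod p (b * s * t)"
  proof -
    have "?P\<^sup>2 * (s * t) = int p ^ n * (int p ^ h' * (s * t))"
      by (simp add: nh h' power2_eq_square algebra_simps)
    then have "chi (1 + ?P\<^sup>2 * (s * t)) = e_mod (p ^ h) (b * (int p ^ h' * (s * t)))"
      by (simp only: chi_one_plus)
    also have "b * (int p ^ h' * (s * t)) = b * s * t * int (p ^ h')"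
      by simp
    also have "p ^ h = p * p ^ h'"
      by (simp add: h')
    also have "e_mod (p * p ^ h') (b * s * t * int (p ^ h')) = e_mod p (b * s * t)"
      by (rule e_mod_cancel) (use p_pos in simp)
    finally show ?thesis .
  qed
  ultimately have "chi (1 + ?P * s) * chi (1 + ?P * t) = chi (1 + ?P * (s + t)) * e_mod p (b * s * t)"
    by (simp only: chi_mult)
  then show ?thesis
    by (simp add: local_factor_def distrib_left e_mod_add mult_ac)
qed

lemma local_factor_periodic:
  assumes "odd m" "[x0 = - b] (mod int p ^ h)"
  shows "periodic_mod p (local_factor x0)"
proof (rule periodic_modI)
  fix t
  have "n = Suc h"
    using assms(1) by (auto simp: h_def n_def elim!: oddE)
  then show "local_factor x0 (t + int p) = local_factor x0 t"
    using local_factor_shift [OF assms(2), of t 1] by simp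
qed

text \<open>The function \<open>t \<mapsto> e (b * M * t\<^sup>2 / p)\<close> satisfies the functional equation of
  \<open>local_factor_add\<close>, since \<open>2 * M\<close> is \<open>- 1\<close> modulo \<open>p\<close>. The quotient of the two is an additive
  character modulo \<open>p\<close>, which is trivial as soon as it is trivial at one unit.\<close>

lemma local_factor_quadratic:
  assumes "odd m" and pM: "p = 2 * M + 1" and x0: "[x0 = - b] (mod int p ^ h)"
    and R: "\<not> int p dvd R" and eq: "local_factor x0 R = e_mod p (b * int M * R\<^sup>2)"
  shows "local_factor x0 t = e_mod p (b * int M * t\<^sup>2)"
proof -
  define g where "g = (\<lambda>t. local_factor x0 t * e_mod p (- (b * int M * t\<^sup>2)))"
  obtain d where d: "\<And>t. g t = e_mod p (d * t)"
  proof (rule additive_character_eq [of p g])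
    show "periodic_mod p g"
      unfolding periodic_mod_def
    proof (intro allI impI)
      fix x y assume xy: "[x = y] (mod int p)"
      have "e_mod p (- (b * int M * x\<^sup>2)) = e_mod p (- (b * int M * y\<^sup>2))"
        by (intro e_mod_cong cong_uminus cong_scalar_left cong_pow xy)
      then show "g x = g y"
        using periodic_modD [OF local_factor_periodic [OF assms(1) x0] xy] by (simp add: g_def)
    qed
    show "g 0 = 1"
      by (simp add: g_def local_factor_def chi_1)
    fix s t
    let ?Q = "\<lambda>t. e_mod p (- (b * int M * t\<^sup>2))"
    have "?Q (s + t) = e_mod p (b * s * t + (- (b * int M * s\<^sup>2) + - (b * int M * t\<^sup>2)))"
    proof (rule e_mod_cong)
      have "- (b * int M * (s + t)\<^sup>2) = b * s * t + (- (b * int M * s\<^sup>2) + - (b * int M * t\<^sup>2)) + int p * (- (b * s * t))"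
        by (simp add: pM power2_eq_square algebra_simps)
      then show "[- (b * int M * (s + t)\<^sup>2) = b * s * t + (- (b * int M * s\<^sup>2) + - (b * int M * t\<^sup>2))] (mod int p)"
        by (simp only: cong_iff_dvd_diff) simp
    qed
    then have "?Q (s + t) = e_mod p (b * s * t) * (?Q s * ?Q t)"
      by (simp only: e_mod_add)
    then have "g (s + t) = (local_factor x0 (s + t) * e_mod p (b * s * t)) * (?Q s * ?Q t)"
      by (simp only: g_def mult.assoc)
    also have "\<dots> = g s * g t"
      unfolding local_factor_add [OF assms(1), symmetric] by (simp only: g_def mult_ac)
    finally show "g (s + t) = g s * g t" .
  qed (use p_pos in auto)
  have "e_mod p (d * R) = 1"
    by (simp add: d [symmetric] g_def eq flip: e_mod_add)
  then have "int p dvd d * R"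
    using p_pos by (simp add: e_mod_eq_1_iff)
  then have "int p dvd d"
    using R prime_int prime_dvd_mult_iff by blast
  then have "g t = 1"
    using p_pos by (simp add: d e_mod_eq_1_iff)
  then show ?thesis
    by (simp add: g_def e_mod_minus field_simps)
qed

lemma stationary_congI:
  assumes c: "[c = b * Rn] (mod int p ^ h)" and x: "[x * R = - c] (mod int p ^ h)"
    and R: "[R = Rn] (mod int p ^ h)" and Rn: "\<not> int p dvd Rn"
  shows "[x = - b] (mod int p ^ h)"
proof -
  have "coprime Rn (int p ^ h)"
    using Rn h_pos coprime_prime_power_iff [of h] by simp
  moreover have "[x * Rn = - b * Rn] (mod int p ^ h)"
  proof -
    have "[x * Rn = x * R] (mod int p ^ h)"
      by (intro cong_scalar_left cong_sym [OF R])
    also have "[x * R = - c] (mod int p ^ h)"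
      by (rule x)
    also have "[- c = - (b * Rn)] (mod int p ^ h)"
      by (intro cong_uminus c)
    finally show ?thesis by simp
  qed
  ultimately show ?thesis
    using cong_mult_rcancel by blast
qed

text \<open>Here \<open>x\<close> stands for \<open>- c / R\<close>. The factor \<open>- 2 * r * c\<close> arises because
  the local sum is the quadratic Gauss sum for \<open>b * M\<close>, where \<open>b\<close> is \<open>c / r\<close> and \<open>M\<close> is
  \<open>- 1 / 2\<close> modulo \<open>p\<close>, and \<open>4 * r\<^sup>2\<close> is a square.\<close>

theorem gauss_sum_odd_prime:
  fixes a r R c :: int and j :: nat
  assumes p: "odd p" "p ^ m \<noteq> 27"
    and a: "primitive_root (p ^ m) a" and r: "a ^ totient p = 1 + r * int p"
    and c: "chi a = e_mod (totient (p ^ m)) c"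
    and j: "n \<le> j" and R: "a ^ totient (p ^ j) = 1 + R * int p ^ j"
    and x: "[x * R = - c] (mod int p ^ m)"
  shows "gauss_sum chi (p ^ m) = of_real (real p powr (real m / 2)) * chi x * e_mod (p ^ m) x *
    (of_int (Legendre (- 2 * r * c) (int p)) ^ m * eps (p ^ m))"
proof -
  obtain M where pM: "p = 2 * M + 1"
    using p(1) by (elim oddE)
  note a_ndvd = euler_quotient_primitive_root(1) [OF prime m a]
  let ?R = "euler_quotient p a"
  have r_eq: "r = ?R 1"
    using r p_pos by (intro euler_quotient_unique) auto
  have R_eq: "R = ?R j"
    using R p_pos by (intro euler_quotient_unique) auto
  have r_ndvd: "\<not> int p dvd r"
    using euler_quotient_primitive_root(2) [OF prime m a] by (simp add: r_eq)
  have R1: "[?R i = r] (mod int p)" if "i > 0" for i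
    using euler_quotient_cong [OF prime p(1) a_ndvd, of 1 i] that by (simp add: r_eq)
  have R_ndvd: "\<not> int p dvd ?R i" if "i > 0" for i
    using cong_dvd_iff [OF R1 [OF that]] r_ndvd by simp
  have Rn: "[R = ?R n] (mod int p ^ n)"
    using euler_quotient_cong [OF prime p(1) a_ndvd n_pos j] by (simp add: R_eq)
  have "e_mod (p ^ h) c = e_mod (p ^ h) (b * ?R n)"
    using chi_euler_quotient [OF a_ndvd n_pos _ c] chi_one_plus [of "?R n"] h_plus_n m_diff_n by simp
  then have cb: "[c = b * ?R n] (mod int p ^ h)"
    using p_pos by (simp add: e_mod_eq_iff)
  have x_b: "[x = - b] (mod int p ^ h)"
  proof (rule stationary_congI [OF cb])
    show "[x * R = - c] (mod int p ^ h)"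
      using x h_plus_n by (rule_tac cong_dvd_modulus) (auto intro: le_imp_power_dvd)
    show "[R = ?R n] (mod int p ^ h)"
      using Rn h_le_n by (rule_tac cong_dvd_modulus) (auto intro: le_imp_power_dvd)
  qed (rule R_ndvd [OF n_pos])
  have modp: "[y = z] (mod int p)" if "[y = z] (mod int p ^ h)" for y z
    using that h_pos by (rule_tac cong_dvd_modulus) (auto intro: dvd_power)
  have cr: "[c = b * r] (mod int p)"
    using cong_trans [OF modp [OF cb] cong_scalar_left [OF R1 [OF n_pos]]] .
  have c_ndvd: "\<not> int p dvd c"
    using cong_dvd_iff [OF cr] b_not_dvd r_ndvd prime_int by (simp add: prime_dvd_mult_iff)
  have two: "\<not> int p dvd 2"
  proof
    assume "int p dvd 2"
    then have "p \<le> 2"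
      using zdvd_imp_le [of "int p" 2] by simp
    then have "p = 2"
      using p_gt_1 by simp
    then show False using p(1) by simp
  qed
  let ?L = "Legendre (- 2 * r * c) (int p)"
  have "\<not> int p dvd - 2 * r * c"
    using two r_ndvd c_ndvd prime_int by (simp add: prime_dvd_mult_iff)
  then have L2: "?L ^ 2 = 1"
    by (simp add: Legendre_def cong_0_iff)
  show ?thesis
  proof (cases "even m")
    case True
    then obtain k where k: "m = 2 * k" by (elim evenE)
    have "of_int ?L ^ m = (1::complex)"
      using L2 by (simp add: k power_mult flip: of_int_power)
    moreover have "[p ^ m = 1] (mod 4)"
    proof -
      have "p ^ 2 = 4 * (M * M + M) + 1"
        by (simp add: pM power2_eq_square algebra_simps)
      then have "[p ^ 2 = 1] (mod 4)"
        by (simp add: cong_def)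
      then have "[(p ^ 2) ^ k = 1 ^ k] (mod 4)"
        by (rule cong_pow)
      then show ?thesis
        by (simp add: k power_mult)
    qed
    ultimately show ?thesis
      using gauss_sum_even_exponent [OF True x_b] True powr_half [of p m] p_pos by (simp add: eps_def h_def)
  next
    case False
    then have nh: "n = Suc h"
      by (auto simp: h_def n_def elim!: oddE)
    have m2: "m = 2 * h + 1"
      using False by (auto simp: h_def elim!: oddE)
    have not3: "\<not> (p = 3 \<and> h = 1)"
      using p(2) m2 by auto
    have factor: "local_factor x t = e_mod p (b * int M * t\<^sup>2)" for t
    proof (rule local_factor_quadratic [OF False pM x_b R_ndvd [OF h_pos]])
      \<comment> \<open>The local factor is tested at \<open>R_h\<close>. There the phase is \<open>x * (R_h - R)\<close>, and the
    second-order expansion of \<open>R\<close> leaves only the quadratic term.\<close>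
      have "local_factor x (?R h) = e_mod (p ^ n) (c + x * ?R h)"
      proof -
        have "h \<le> m" "m - h = n"
          using h_plus_n by auto
        then show ?thesis
          using chi_euler_quotient [OF a_ndvd h_pos _ c] by (simp only: local_factor_def e_mod_add)
      qed
      also have "\<dots> = e_mod (p ^ n) (b * int M * (?R h)\<^sup>2 * int (p ^ h))"
      proof (rule e_mod_cong)
        have "[c + x * ?R h = - (x * R) + x * ?R h] (mod int p ^ n)"
        proof (intro cong_add cong_refl)
          have "[x * R = - c] (mod int p ^ n)"
            using x h_plus_n by (rule_tac cong_dvd_modulus) (auto intro: le_imp_power_dvd)
          from cong_uminus [OF cong_sym [OF this]] show "[c = - (x * R)] (mod int p ^ n)"
            by simp
        qed
        also have "- (x * R) + x * ?R h = x * (?R h - R)"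
          by (simp add: algebra_simps)
        also have "[x * (?R h - R) = x * (?R h - (?R h + int M * int p ^ h * (?R h)\<^sup>2))] (mod int p ^ n)"
        proof (intro cong_scalar_left cong_diff cong_refl)
          have "[?R n = ?R h + int M * int p ^ h * (?R h)\<^sup>2] (mod int p ^ n)"
            unfolding nh by (rule euler_quotient_Suc(2) [OF prime pM a_ndvd h_pos not3])
          with Rn show "[R = ?R h + int M * int p ^ h * (?R h)\<^sup>2] (mod int p ^ n)"
            by (rule cong_trans)
        qed
        also have "x * (?R h - (?R h + int M * int p ^ h * (?R h)\<^sup>2))
            = int p ^ h * (- x * (int M * (?R h)\<^sup>2))"
          by (simp add: algebra_simps)
        also have "[int p ^ h * (- x * (int M * (?R h)\<^sup>2)) = int p ^ h * (b * (int M * (?R h)\<^sup>2))] (mod int p ^ n)"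
        proof -
          have "[- x = b] (mod int p)"
            using cong_uminus [OF modp [OF x_b]] by simp
          then have "[- x * (int M * (?R h)\<^sup>2) = b * (int M * (?R h)\<^sup>2)] (mod int p)"
            by (rule cong_scalar_right)
          then have "[int p ^ h * (- x * (int M * (?R h)\<^sup>2)) = int p ^ h * (b * (int M * (?R h)\<^sup>2))]
              (mod int p ^ h * int p)"
            by (rule cong_cmult_leftI)
          then show ?thesis
            by (simp only: nh power_Suc2)
        qed
        also have "int p ^ h * (b * (int M * (?R h)\<^sup>2)) = b * int M * (?R h)\<^sup>2 * int (p ^ h)"
          by simp
        finally show "[c + x * ?R h = b * int M * (?R h)\<^sup>2 * int (p ^ h)] (mod int (p ^ n))"
          by simp
      qed
      also have "\<dots> = e_mod p (b * int M * (?R h)\<^sup>2)"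
        unfolding nh power_Suc by (rule e_mod_cancel) (use p_pos in simp)
      finally show "local_factor x (?R h) = e_mod p (b * int M * (?R h)\<^sup>2)" .
    qed
    have bM: "\<not> int p dvd b * int M"
    proof
      assume "int p dvd b * int M"
      then have "int p dvd int M"
        using b_not_dvd prime_int prime_dvd_mult_iff by blast
      moreover have "M > 0"
        using pM p_gt_1 by simp
      ultimately show False
        using pM zdvd_imp_le [of "int p" "int M"] by simp
    qed
    have "(\<Sum>t\<in>{0..<int (p ^ (n - h))}. local_factor x t) = quadratic_gauss_sum p (b * int M)"
      by (simp add: nh factor quadratic_gauss_sum_def)
    also have "\<dots> = of_int (Legendre (b * int M) (int p)) * (eps p * of_real (sqrt p))"
      using quadratic_gauss_sum_Legendre [OF prime p(1) bM] quadratic_gauss_sum_1 [OF p(1)] by simp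
    also have "Legendre (b * int M) (int p) = ?L"
    proof (rule Legendre_square_cong [OF prime])
      show "\<not> int p dvd 2 * r"
        using two r_ndvd prime_int by (simp add: prime_dvd_mult_iff)
      show "\<not> int p dvd 1"
        using p_gt_1 by simp
      \<comment> \<open>\<open>4 * M\<close> is \<open>2 * p - 2\<close>, that is \<open>- 2\<close> modulo \<open>p\<close>.\<close>
      have "b * int M * (2 * r)\<^sup>2 = - 2 * r * (b * r) + int p * (2 * b * r\<^sup>2)"
        by (simp add: pM power2_eq_square algebra_simps)
      then have "[b * int M * (2 * r)\<^sup>2 = - 2 * r * (b * r)] (mod int p)"
        by (simp add: cong_iff_dvd_diff)
      also have "[- 2 * r * (b * r) = - 2 * r * c] (mod int p)"
        by (intro cong_scalar_left cong_sym [OF cr])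
      finally show "[b * int M * (2 * r)\<^sup>2 = - 2 * r * c * 1\<^sup>2] (mod int p)"
        by simp
    qed
    finally have G: "gauss_sum chi (p ^ m) = of_nat (p ^ h) * (chi x * e_mod (p ^ m) x *
        (of_int ?L * (eps p * of_real (sqrt p))))"
      using gauss_sum_reduced [OF x_b] by simp
    have "?L ^ m = ?L ^ (2 * h + 1)"
      by (simp only: m2 [symmetric])
    also have "\<dots> = ?L"
      using L2 by (simp only: power_add power_one_right power_mult power_one mult_1)
    finally have "of_int ?L ^ m = (of_int ?L :: complex)"
      by (simp only: of_int_power [symmetric])
    moreover have "eps (p ^ m) = eps p"
    proof -
      have "p ^ 2 = 4 * (M * M + M) + 1"
        by (simp add: pM power2_eq_square algebra_simps)
      then have "[p ^ 2 = 1] (mod 4)"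
        by (simp add: cong_def)
      then have "[(p ^ 2) ^ h * p = 1 ^ h * p] (mod 4)"
        by (intro cong_scalar_right cong_pow)
      moreover have "(p ^ 2) ^ h * p = p ^ (2 * h + 1)"
        by (simp add: power_mult)
      ultimately have "[p ^ m = p] (mod 4)"
        by (simp only: m2 [symmetric] power_one mult_1)
      then show ?thesis
        unfolding eps_def by (metis cong_sym cong_trans)
    qed
    ultimately show ?thesis
      unfolding G using False powr_half [of p m] p_pos by (simp add: h_def)
  qed
qed

end

section \<open>The quadratic character of 2\<close>

text \<open>The value of the Jacobi symbol \<open>(2 / n)\<close> for odd \<open>n\<close> according to the second supplementary law.\<close>

definition two_symbol :: "nat \<Rightarrow> int" where
  "two_symbol n = (if n mod 8 = 1 \<or> n mod 8 = 7 then 1 else - 1)"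

lemma two_symbol_mult:
  assumes "odd x" "odd y"
  shows "two_symbol (x * y) = two_symbol x * two_symbol y"
proof -
  have "x mod 8 = 1 \<or> x mod 8 = 3 \<or> x mod 8 = 5 \<or> x mod 8 = 7"
    and "y mod 8 = 1 \<or> y mod 8 = 3 \<or> y mod 8 = 5 \<or> y mod 8 = 7"
    using assms by presburger+
  moreover have "x * y mod 8 = (x mod 8) * (y mod 8) mod 8"
    by (simp add: mod_mult_eq)
  ultimately show ?thesis
    unfolding two_symbol_def by auto
qed

text \<open>Gauss' lemma: among the numbers \<open>2 * x\<close> with \<open>1 \<le> x \<le> M\<close>, those above \<open>M\<close> have
  \<open>x > M div 2\<close>.\<close>

lemma Legendre_2:
  assumes "prime p" "odd p"
  shows "Legendre 2 (int p) = two_symbol p"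
proof -
  obtain M where M: "p = 2 * M + 1"
    using assms(2) by (elim oddE)
  have "M > 0" using M assms(1) by (intro Nat.gr0I) auto
  interpret GAUSS p 2
    using assms M \<open>M > 0\<close> by unfold_locales (auto simp: cong_0_iff dest: zdvd_imp_le)
  have M2: "(int p - 1) div 2 = int M"
    using M by simp
  have C: "C = (\<lambda>x. x * 2) ` {0<..int M}"
    unfolding C_def B_def A_def M2 image_image using M by (intro image_cong) auto
  have "E = (\<lambda>x. x * 2) ` {int (M div 2)<..int M}"
    unfolding E_def C M2 by (auto simp: zdiv_int)
  then have "card E = M - M div 2"
    by (simp add: card_image inj_on_def)
  then have L: "Legendre 2 (int p) = (-1) ^ (M - M div 2)"
    using gauss_lemma by simp
  have "even (M - M div 2) \<longleftrightarrow> p mod 8 = 1 \<or> p mod 8 = 7"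
    unfolding M by presburger
  then show ?thesis
    unfolding L two_symbol_def by simp
qed

lemma Jacobi_2:
  assumes "odd c"
  shows "Jacobi 2 c = two_symbol c"
proof -
  have aux: "(\<Prod>p\<in>#A. Legendre 2 (int p)) = two_symbol (\<Prod>\<^sub># A) \<and> odd (\<Prod>\<^sub># A)"
    if "\<And>p. p \<in># A \<Longrightarrow> prime p \<and> odd p" for A
    using that
  proof (induction A)
    case empty
    then show ?case by (simp add: two_symbol_def)
  next
    case (add p A)
    then have "(\<Prod>p\<in>#A. Legendre 2 (int p)) = two_symbol (\<Prod>\<^sub># A)" "odd (\<Prod>\<^sub># A)" "prime p" "odd p"
      by auto
    then show ?case
      by (simp add: Legendre_2 two_symbol_mult)
  qed
  have "c \<noteq> 0" using assms by (intro notI) simp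
  have "prime p \<and> odd p" if "p \<in># prime_factorization c" for p
  proof -
    have "p dvd c" "prime p" using that by auto
    then show ?thesis using assms dvd_trans by blast
  qed
  from aux [OF this] show ?thesis
    using \<open>c \<noteq> 0\<close> by (simp add: Jacobi_def prod_mset_prime_factorization)
qed

section \<open>Powers of five modulo powers of two\<close>

definition five_quotient :: "nat \<Rightarrow> int" where
  "five_quotient j = (5 ^ (2 ^ (j - 2)) - 1) div 2 ^ j"

lemma five_quotient_unique:
  assumes "5 ^ (2 ^ (j - 2)) = 1 + R * 2 ^ j"
  shows "R = five_quotient j"
  using assms by (simp add: five_quotient_def)

lemma five_quotient_2: "five_quotient 2 = 1"
  by (simp add: five_quotient_def)

lemma five_quotient:
  assumes "j \<ge> 2"
  shows "5 ^ (2 ^ (j - 2)) = 1 + five_quotient j * 2 ^ j"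
proof -
  have "\<exists>R::int. 5 ^ (2 ^ (j - 2)) = 1 + R * 2 ^ j"
    using assms
  proof (induction j rule: dec_induct)
    case base
    then show ?case by (intro exI [of _ 1]) simp
  next
    case (step j)
    then obtain R :: int where R: "5 ^ (2 ^ (j - 2)) = 1 + R * 2 ^ j" by blast
    obtain i where i: "j = Suc (Suc i)"
      using step by (metis add_2_eq_Suc le_Suc_ex)
    have "(5::int) ^ (2 ^ (Suc j - 2)) = (5 ^ (2 ^ (j - 2)))\<^sup>2"
      by (simp add: i mult.commute flip: power_mult)
    also have "\<dots> = 1 + (R + 2 ^ (j - 1) * R\<^sup>2) * 2 ^ Suc j"
      unfolding R by (simp add: i power2_eq_square algebra_simps)
    finally show ?case by blast
  qed
  then show ?thesis
    using five_quotient_unique by metis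
qed

text \<open>Squaring \<open>1 + R * 2^j\<close> produces only three terms, so the recursion is exact.\<close>

lemma five_quotient_Suc:
  assumes "j \<ge> 2"
  shows "five_quotient (Suc j) = five_quotient j + 2 ^ (j - 1) * (five_quotient j)\<^sup>2"
proof -
  let ?R = "five_quotient j"
  obtain i where i: "j = Suc (Suc i)"
    using assms by (metis add_2_eq_Suc le_Suc_ex)
  have "(5::int) ^ (2 ^ (Suc j - 2)) = (5 ^ (2 ^ (j - 2)))\<^sup>2"
    by (simp add: i mult.commute flip: power_mult)
  also have "\<dots> = 1 + (?R + 2 ^ (j - 1) * ?R\<^sup>2) * 2 ^ Suc j"
    unfolding five_quotient [OF assms] by (simp add: i power2_eq_square algebra_simps)
  finally show ?thesis
    by (rule five_quotient_unique [symmetric])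
qed

lemma odd_five_quotient: "j \<ge> 2 \<Longrightarrow> odd (five_quotient j)"
  by (induction j rule: dec_induct) (auto simp: five_quotient_2 five_quotient_Suc)

lemma five_quotient_cong:
  assumes "i \<ge> 2" "i \<le> j"
  shows "[five_quotient j = five_quotient i] (mod 2 ^ (i - 1))"
  using assms(2)
proof (induction j rule: dec_induct)
  case base
  then show ?case by simp
next
  case (step j)
  have "(2::int) ^ (i - 1) dvd 2 ^ (j - 1) * (five_quotient j)\<^sup>2"
    using step by (intro dvd_mult2 le_imp_power_dvd) simp
  then have "[five_quotient (Suc j) = five_quotient j] (mod 2 ^ (i - 1))"
    using step assms(1) by (simp add: five_quotient_Suc cong_iff_dvd_diff)
  then show ?case
    using step.IH cong_trans by blast
qed

text \<open>The quotient at 4 is 39, and each further step of the recursion adds a multiple of 8.\<close>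

lemma five_quotient_mod_8:
  assumes "j \<ge> 4"
  shows "[five_quotient j = - 1] (mod 8)"
proof -
  have "five_quotient 3 = 3"
    using five_quotient_Suc [of 2] by (simp add: five_quotient_2)
  then have "five_quotient 4 = 39"
    using five_quotient_Suc [of 3] by simp
  show ?thesis
    using assms
  proof (induction j rule: dec_induct)
    case base
    then show ?case using \<open>five_quotient 4 = 39\<close> by (simp add: cong_def)
  next
    case (step j)
    have "(2::int) ^ 3 dvd 2 ^ (j - 1) * (five_quotient j)\<^sup>2"
      using step by (intro dvd_mult2 le_imp_power_dvd) simp
    then have "[five_quotient (Suc j) = five_quotient j] (mod 8)"
      using step by (simp add: five_quotient_Suc cong_iff_dvd_diff)
    then show ?case
      using step.IH cong_trans by blast
  qed
qed

text \<open>Odd squares are 1 modulo 8.\<close>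

lemma five_quotient_Suc_cong:
  assumes "i \<ge> 2"
  shows "[five_quotient (Suc i) = five_quotient i + 2 ^ (i - 1)] (mod 2 ^ (i + 2))"
proof -
  obtain k where k: "five_quotient i = 2 * k + 1"
    using odd_five_quotient [OF assms] by (elim oddE)
  have "2 dvd k * (k + 1)" by simp
  then obtain l where l: "k * (k + 1) = 2 * l" by (elim dvdE)
  have "(five_quotient i)\<^sup>2 = 1 + 4 * (k * (k + 1))"
    by (simp add: k power2_eq_square algebra_simps)
  also have "\<dots> = 1 + 8 * l"
    by (simp add: l)
  finally have "five_quotient (Suc i) - (five_quotient i + 2 ^ (i - 1)) = 2 ^ (i - 1) * 8 * l"
    using assms by (simp add: five_quotient_Suc algebra_simps)
  also have "(2::int) ^ (i - 1) * 8 = 2 ^ (i + 2)"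
    using assms by (cases i) simp_all
  finally show ?thesis
    by (simp add: cong_iff_dvd_diff)
qed

text \<open>Three steps of the recursion add \<open>(1 + 2 + 4) * 2^(i-1)\<close>; all later ones are divisible by
  \<open>2^(i+2)\<close>.\<close>

lemma five_quotient_far_cong:
  assumes "i \<ge> 2" "j \<ge> i + 3"
  shows "[five_quotient j = five_quotient i + 7 * 2 ^ (i - 1)] (mod 2 ^ (i + 2))"
proof -
  have "[five_quotient j = five_quotient (i + 3)] (mod 2 ^ (i + 2))"
    using five_quotient_cong [of "i + 3" j] assms by simp
  also have "[five_quotient (i + 3) = five_quotient (i + 2) + 2 ^ (i + 1)] (mod 2 ^ (i + 2))"
    using five_quotient_Suc_cong [of "i + 2"] assms
    by (rule_tac cong_dvd_modulus [of _ _ "2 ^ (i + 2 + 2)"]) (auto simp: numeral_eq_Suc intro: le_imp_power_dvd)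
  also have "[five_quotient (i + 2) + 2 ^ (i + 1) = (five_quotient (i + 1) + 2 ^ i) + 2 ^ (i + 1)] (mod 2 ^ (i + 2))"
    using five_quotient_Suc_cong [of "i + 1"] assms
    by (intro cong_add cong_refl)
      (rule cong_dvd_modulus [of _ _ "2 ^ (i + 1 + 2)"], auto simp: numeral_eq_Suc intro: le_imp_power_dvd)
  also have "[(five_quotient (i + 1) + 2 ^ i) + 2 ^ (i + 1) = ((five_quotient i + 2 ^ (i - 1)) + 2 ^ i) + 2 ^ (i + 1)] (mod 2 ^ (i + 2))"
    using five_quotient_Suc_cong [of i] assms by (intro cong_add cong_refl) simp
  also have "((five_quotient i + 2 ^ (i - 1)) + 2 ^ i) + 2 ^ (i + 1) = five_quotient i + 7 * 2 ^ (i - 1)"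
    using assms by (cases i) simp_all
  finally show ?thesis .
qed

section \<open>Powers of two\<close>

lemma omega_eq: "omega = (1 + \<i>) / of_real (sqrt 2)"
proof -
  have "omega = cis (pi / 4)"
    by (simp add: omega_def cis_conv_exp mult.commute)
  also have "\<dots> = (1 + \<i>) / of_real (sqrt 2)"
    by (simp add: complex_eq_iff cos_45 sin_45 real_div_sqrt field_simps)
  finally show ?thesis .
qed

lemma omega_squared: "omega\<^sup>2 = \<i>"
  by (simp add: omega_eq power_divide power2_eq_square algebra_simps flip: of_real_mult)

lemma sqrt2_omega: "of_real (sqrt 2) * omega = 1 + \<i>"
  by (simp add: omega_eq)

lemma e_mod_4: "e_mod 4 (int c) = \<i> ^ c"
proof -
  have "e_mod 4 1 = cis (pi / 2)"
    by (simp add: e_mod_def cis_conv_exp mult.commute)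
  then show ?thesis
    using e_mod_mult_nat [of 4 1 c] by simp
qed

lemma e_mod_8: "e_mod 8 (int c) = omega ^ c"
proof -
  have "e_mod 8 1 = omega"
    by (simp add: e_mod_def omega_def mult.commute)
  then show ?thesis
    using e_mod_mult_nat [of 8 1 c] by simp
qed

text \<open>With \<open>w = omega^c\<close> this says \<open>1 + w\<^sup>2 = sqrt 2 * (2 / c) * w\<close>, that is
  \<open>w + 1 / w = sqrt 2 * (2 / c)\<close>: the symbol is the sign of \<open>cos (pi * c / 4)\<close>.\<close>

lemma one_plus_ii_power:
  assumes "odd c"
  shows "1 + \<i> ^ c = of_real (sqrt 2) * (of_int (two_symbol c) * omega ^ c)"
proof -
  have w8: "omega ^ 8 = 1"
  proof -
    have "omega ^ 8 = (omega\<^sup>2) ^ 4"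
      by (simp flip: power_mult)
    then show ?thesis by (simp add: omega_squared)
  qed
  have w: "omega ^ c = omega ^ (c mod 8)"
  proof -
    have "omega ^ c = omega ^ (8 * (c div 8) + c mod 8)" by simp
    also have "\<dots> = omega ^ (c mod 8)"
      by (simp only: power_add power_mult w8) simp
    finally show ?thesis .
  qed
  have i: "\<i> ^ c = (omega ^ c)\<^sup>2"
    by (simp only: omega_squared [symmetric] power_mult [symmetric] mult.commute)
  have "c mod 8 = 1 \<or> c mod 8 = 3 \<or> c mod 8 = 5 \<or> c mod 8 = 7"
    using assms by presburger
  moreover have w3: "omega ^ 3 = \<i> * omega" "omega ^ 5 = - omega" "omega ^ 7 = - (\<i> * omega)"
    using omega_squared by (simp_all add: numeral_eq_Suc flip: mult.assoc)
  ultimately show ?thesis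
    unfolding i w using sqrt2_omega
    by (auto simp: two_symbol_def omega_squared power_mult_distrib algebra_simps)
qed

locale primitive_two_power_character = primitive_prime_power_character 2 m chi b for m chi b
begin

lemma chi_five_quotient:
  assumes i: "2 \<le> i" "i \<le> m" and c: "chi 5 = e_mod (2 ^ (m - 2)) c"
  shows "chi (1 + 2 ^ i * five_quotient i) = e_mod (2 ^ (m - i)) c"
proof -
  have "m - 2 = (m - i) + (i - 2)" using i by simp
  then have pw: "(2::nat) ^ (m - 2) = 2 ^ (m - i) * 2 ^ (i - 2)"
    by (simp only: power_add)
  have "chi (1 + 2 ^ i * five_quotient i) = chi (5 ^ (2 ^ (i - 2)))"
    using five_quotient [OF i(1)] by (simp add: mult.commute)
  also have "\<dots> = e_mod (2 ^ (m - 2)) (c * int (2 ^ (i - 2)))"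
    by (simp only: chi_power c e_mod_mult_nat)
  also have "\<dots> = e_mod (2 ^ (m - i)) c"
    unfolding pw by (rule e_mod_cancel) simp
  finally show ?thesis .
qed

lemma odd_b: "odd b"
  using b_not_dvd by simp

text \<open>Evaluate \<open>chi (1 + 2^n * R_n)\<close> once through \<open>b\<close> and once as a power of \<open>chi 5\<close>.\<close>

lemma exponent_cong:
  assumes "m \<ge> 3" and c: "chi 5 = e_mod (2 ^ (m - 2)) c"
  shows "[c = b * five_quotient n] (mod 2 ^ h)" and "odd c"
proof -
  have n2: "n \<ge> 2" "n \<le> m"
    using assms(1) by (auto simp: n_def)
  have "e_mod (2 ^ h) c = e_mod (2 ^ h) (b * five_quotient n)"
    using chi_five_quotient [OF n2 c] chi_one_plus [of "five_quotient n"] m_diff_n by simp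
  then show cong: "[c = b * five_quotient n] (mod 2 ^ h)"
    by (simp add: e_mod_eq_iff)
  then have "[c = b * five_quotient n] (mod 2)"
    using h_pos by (rule_tac cong_dvd_modulus) (auto intro: dvd_power)
  from cong_dvd_iff [OF this] show "odd c"
    using odd_b odd_five_quotient [OF n2(1)] by simp
qed

text \<open>As before \<open>x\<close> stands for \<open>- c / R\<close>; it is congruent to \<open>c\<close> modulo 8 because \<open>R\<close> is \<open>- 1\<close> there,
  and this is how \<open>omega^c\<close> and \<open>\<i>^c\<close> enter.\<close>

theorem gauss_sum_two_power:
  fixes c j :: nat and R x :: int
  assumes m5: "m \<ge> 5" and c: "chi 5 = e_mod (2 ^ (m - 2)) (int c)"
    and j: "n + 2 \<le> j" and R: "5 ^ (2 ^ (j - 2)) = 1 + R * 2 ^ j"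
    and x: "[x * R = - int c] (mod 2 ^ m)"
  shows "gauss_sum chi (2 ^ m) = of_real (2 powr (real m / 2)) * chi x * e_mod (2 ^ m) x *
    (of_int (Jacobi 2 c) ^ m * omega ^ c)"
proof -
  let ?S = five_quotient
  have R_eq: "R = ?S j"
    using R by (rule five_quotient_unique)
  have h2: "h \<ge> 2" and n3: "n \<ge> 3"
    using m5 by (auto simp: h_def n_def)
  have cb: "[int c = b * ?S n] (mod 2 ^ h)" and "odd c"
    using exponent_cong [OF _ c] m5 by auto
  note J = Jacobi_2 [OF \<open>odd c\<close>]
  have two_sq: "two_symbol c ^ 2 = 1"
    by (simp add: two_symbol_def)
  have xR: "[x * R = - int c] (mod 2 ^ i)" if "i \<le> m" for i
    using x that by (rule_tac cong_dvd_modulus) (auto intro: le_imp_power_dvd)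
  have x_c: "[x = int c] (mod 8)"
  proof -
    have "[x * (- 1) = x * R] (mod 8)"
      unfolding R_eq using j n3
      by (intro cong_scalar_left cong_sym [OF five_quotient_mod_8]) simp
    also have "[x * R = - int c] (mod 8)"
      using xR [of 3] m5 by simp
    finally show ?thesis
      using cong_minus_minus_iff [of x "int c" 8] by simp
  qed
  have "n \<ge> 2" using n3 by simp
  show ?thesis
  proof (cases "even m")
    case False
    then have nh: "n = Suc h"
      by (auto simp: h_def n_def elim!: oddE)
    have mh: "m - h = n" "h \<le> m"
      using h_plus_n by auto
    have "[x = - b] (mod int 2 ^ h)"
    proof (rule stationary_congI)
      show "[int c = b * ?S n] (mod int 2 ^ h)" "[x * R = - int c] (mod int 2 ^ h)"
        using cb xR [OF mh(2)] by simp_all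
      show "[R = ?S n] (mod int 2 ^ h)"
        using five_quotient_cong [of n j] j n3 by (simp add: R_eq nh)
      show "\<not> int 2 dvd ?S n"
        using odd_five_quotient [OF \<open>n \<ge> 2\<close>] by simp
    qed
    note x_b = this
    \<comment> \<open>The local factor has period 2 and \<open>R_h\<close> is odd, so its value at \<open>R_h\<close> is the one at 1.\<close>
    have "local_factor x (?S h) = e_mod (2 ^ n) (int c + x * ?S h)"
      using chi_five_quotient [OF h2 mh(2) c] by (simp add: local_factor_def e_mod_add mh(1))
    also have "\<dots> = e_mod (2 ^ n) (x * (2 ^ (h - 1)))"
    proof (rule e_mod_cong)
      have "[int c + x * ?S h = - (x * R) + x * ?S h] (mod 2 ^ n)"
      proof (intro cong_add cong_refl)
        from cong_uminus [OF cong_sym [OF xR [of n]]] show "[int c = - (x * R)] (mod 2 ^ n)"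
          using h_plus_n by simp
      qed
      also have "- (x * R) + x * ?S h = x * (?S h - R)"
        by (simp add: algebra_simps)
      also have "[x * (?S h - R) = x * (?S h - (?S h + 7 * 2 ^ (h - 1)))] (mod 2 ^ n)"
      proof (intro cong_scalar_left cong_diff cong_refl)
        have "[R = ?S h + 7 * 2 ^ (h - 1)] (mod 2 ^ (h + 2))"
          unfolding R_eq by (rule five_quotient_far_cong) (use h2 j nh in auto)
        then show "[R = ?S h + 7 * 2 ^ (h - 1)] (mod 2 ^ n)"
          by (rule cong_dvd_modulus) (simp add: nh le_imp_power_dvd)
      qed
      also have "x * (?S h - (?S h + 7 * 2 ^ (h - 1))) = x * 2 ^ (h - 1) - x * 2 ^ n * 2"
        using h2 by (cases h) (simp_all add: nh)
      also have "[x * 2 ^ (h - 1) - x * 2 ^ n * 2 = x * 2 ^ (h - 1)] (mod 2 ^ n)"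
        by (simp add: cong_iff_dvd_diff)
      finally show "[int c + x * ?S h = x * 2 ^ (h - 1)] (mod int (2 ^ n))"
        by simp
    qed
    also have "\<dots> = e_mod (4 * 2 ^ (h - 1)) (x * int (2 ^ (h - 1)))"
      using h2 by (cases h) (simp_all add: nh)
    also have "\<dots> = e_mod 4 x"
      by (rule e_mod_cancel) simp
    also have "\<dots> = e_mod 4 (int c)"
    proof (rule e_mod_cong)
      show "[x = int c] (mod int 4)"
        using x_c by (rule cong_dvd_modulus) simp
    qed
    also have "\<dots> = \<i> ^ c"
      by (rule e_mod_4)
    finally have "local_factor x (?S h) = \<i> ^ c" .
    moreover have "[?S h = 1] (mod int 2)"
      using odd_five_quotient [OF h2] by (auto simp: cong_def elim!: oddE)
    ultimately have F1: "local_factor x 1 = \<i> ^ c"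
      using periodic_modD [OF local_factor_periodic [OF False x_b]] by metis
    have "{0..<2::int} = {0, 1}" by auto
    then have "gauss_sum chi (2 ^ m) = 2 ^ h * (chi x * e_mod (2 ^ m) x * (1 + \<i> ^ c))"
      using gauss_sum_reduced [OF x_b] F1 by (simp add: nh local_factor_def chi_1)
    moreover have "Jacobi 2 c ^ m = Jacobi 2 c"
    proof -
      obtain k where "m = 2 * k + 1" using False by (elim oddE)
      then show ?thesis by (simp add: J power_mult two_sq)
    qed
    then have "of_int (Jacobi 2 c) ^ m = (of_int (two_symbol c) :: complex)"
      using J by (simp only: of_int_power [symmetric])
    ultimately show ?thesis
      using False powr_half [of 2 m] by (simp add: one_plus_ii_power [OF \<open>odd c\<close>] h_def)
  next
    case True
    then have nh: "h = n"
      by (auto simp: h_def n_def elim!: evenE)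
    obtain i where i: "n = Suc i" "i \<ge> 2"
      using n3 by (cases n) auto
    have im: "i \<le> m" "m - i = Suc n"
      using h_plus_n i nh by auto
    have far: "[R = ?S i + 7 * 2 ^ (i - 1)] (mod 2 ^ Suc n)"
      using five_quotient_far_cong [of i j] i j by (simp add: R_eq)
    \<comment> \<open>\<open>x\<close> is off the stationary class by \<open>2^(n-1)\<close>; multiplying by \<open>5^(2^(n-3))\<close> corrects this
    and changes \<open>chi\<close> and the exponential by known amounts.\<close>
    define x0 where "x0 = x * (1 + 2 ^ i * ?S i)"
    have "[x0 = - b] (mod int 2 ^ h)"
    proof (rule stationary_congI)
      show "[int c = b * ?S n] (mod int 2 ^ h)"
        using cb by simp
      show "[x0 * ?S n = - int c] (mod int 2 ^ h)"
      proof -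
        have e1: "(2::int) ^ i = 2 * 2 ^ (i - 1)" "(2::int) ^ n = 4 * 2 ^ (i - 1)"
          using i by (cases i; simp)+
        obtain k l where kl: "?S i = 2 * k + 1" "?S n = 2 * l + 1"
          using odd_five_quotient [OF i(2)] odd_five_quotient [OF \<open>n \<ge> 2\<close>] by (elim oddE)
        have "[(1 + 2 ^ i * ?S i) * ?S n = ?S n + 2 ^ i] (mod 2 ^ n)"
        proof -
          have "(1 + 2 ^ i * ?S i) * ?S n - (?S n + 2 ^ i) = 2 ^ n * (2 * k * l + k + l)"
            unfolding kl e1 by (simp add: algebra_simps)
          then show ?thesis by (simp add: cong_iff_dvd_diff)
        qed
        also have "[?S n + 2 ^ i = (?S i + 2 ^ (i - 1)) + 2 ^ i] (mod 2 ^ n)"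
        proof (intro cong_add cong_refl)
          show "[?S n = ?S i + 2 ^ (i - 1)] (mod 2 ^ n)"
            using five_quotient_Suc_cong [OF i(2)]
            by (rule_tac cong_dvd_modulus [of _ _ "2 ^ (i + 2)"]) (auto simp: i(1) le_imp_power_dvd)
        qed
        also have "[(?S i + 2 ^ (i - 1)) + 2 ^ i = ?S i + 7 * 2 ^ (i - 1)] (mod 2 ^ n)"
          by (simp add: e1 cong_iff_dvd_diff)
        also have "[?S i + 7 * 2 ^ (i - 1) = R] (mod 2 ^ n)"
          using cong_sym [OF far] by (rule cong_dvd_modulus) simp
        finally have "[x * ((1 + 2 ^ i * ?S i) * ?S n) = x * R] (mod 2 ^ n)"
          by (rule cong_scalar_left)
        also have "[x * R = - int c] (mod 2 ^ n)"
          using h_plus_n by (intro xR) simp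
        finally show ?thesis
          by (simp add: x0_def nh mult.assoc)
      qed
      show "\<not> int 2 dvd ?S n"
        using odd_five_quotient [OF \<open>n \<ge> 2\<close>] by simp
    qed simp
    then have G: "gauss_sum chi (2 ^ m) = 2 ^ h * (chi x0 * e_mod (2 ^ m) x0)"
      using gauss_sum_even_exponent [OF True] by simp
    have "e_mod (2 ^ m) x0 = e_mod (2 ^ m) x * e_mod (2 ^ m) (x * ?S i * int (2 ^ i))"
      by (simp add: x0_def algebra_simps flip: e_mod_add)
    also have "(2::nat) ^ m = 2 ^ Suc n * 2 ^ i"
    proof -
      have "Suc n + i = m" using im by simp
      then show ?thesis by (simp only: power_add [symmetric])
    qed
    then have "e_mod (2 ^ m) (x * ?S i * int (2 ^ i)) = e_mod (2 ^ Suc n) (x * ?S i)"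
      by (simp only:) (rule e_mod_cancel, simp)
    finally have e0: "e_mod (2 ^ m) x0 = e_mod (2 ^ m) x * e_mod (2 ^ Suc n) (x * ?S i)" .
    have c0: "chi x0 = chi x * e_mod (2 ^ Suc n) (int c)"
      using chi_five_quotient [OF i(2) im(1) c] by (simp only: x0_def chi_mult im(2))
    have "e_mod (2 ^ Suc n) (int c) * e_mod (2 ^ Suc n) (x * ?S i) = e_mod (2 ^ Suc n) (int c + x * ?S i)"
      by (simp only: e_mod_add)
    also have "\<dots> = e_mod (2 ^ Suc n) (x * 2 ^ (i - 1))"
    proof (rule e_mod_cong)
      have "[int c + x * ?S i = - (x * R) + x * ?S i] (mod 2 ^ Suc n)"
      proof (intro cong_add cong_refl)
        from cong_uminus [OF cong_sym [OF xR [of "Suc n"]]] show "[int c = - (x * R)] (mod 2 ^ Suc n)"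
          using im by simp
      qed
      also have "- (x * R) + x * ?S i = x * (?S i - R)"
        by (simp add: algebra_simps)
      also have "[x * (?S i - R) = x * (?S i - (?S i + 7 * 2 ^ (i - 1)))] (mod 2 ^ Suc n)"
        by (intro cong_scalar_left cong_diff cong_refl far)
      also have "x * (?S i - (?S i + 7 * 2 ^ (i - 1))) = x * 2 ^ (i - 1) - x * 2 ^ Suc n"
        using i by (cases i) (simp_all add: i(1))
      also have "[x * 2 ^ (i - 1) - x * 2 ^ Suc n = x * 2 ^ (i - 1)] (mod 2 ^ Suc n)"
        by (simp add: cong_iff_dvd_diff)
      finally show "[int c + x * ?S i = x * 2 ^ (i - 1)] (mod int (2 ^ Suc n))"
        by simp
    qed
    also have "\<dots> = e_mod (8 * 2 ^ (i - 1)) (x * int (2 ^ (i - 1)))"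
      using i by (cases i) simp_all
    also have "\<dots> = e_mod 8 x"
      by (rule e_mod_cancel) simp
    also have "\<dots> = e_mod 8 (int c)"
      using x_c by (intro e_mod_cong) simp
    also have "\<dots> = omega ^ c"
      by (rule e_mod_8)
    finally have "chi x0 * e_mod (2 ^ m) x0 = chi x * e_mod (2 ^ m) x * omega ^ c"
      by (simp only: c0 e0 mult_ac)
    moreover have "Jacobi 2 c ^ m = 1"
    proof -
      obtain k where "m = 2 * k" using True by (elim evenE)
      then show ?thesis by (simp add: J power_mult two_sq)
    qed
    then have "of_int (Jacobi 2 c) ^ m = (1 :: complex)"
      by (simp only: of_int_power [symmetric]) simp
    ultimately show ?thesis
      using True powr_half [of 2 m] by (simp add: G h_def)
  qed
qed

theorem gauss_sum_4:
  assumes "m = 2"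
  shows "gauss_sum chi (2 ^ m) = of_real (2 powr (real m / 2)) * \<i>"
proof -
  have "h = 1" unfolding h_def using assms by simp
  then have "[1 = - b] (mod int 2 ^ h)"
    using odd_b by (auto simp: cong_iff_dvd_diff)
  then have "gauss_sum chi (2 ^ m) = of_nat (2 ^ h) * (chi 1 * e_mod (2 ^ m) 1)"
    using assms by (intro gauss_sum_even_exponent) simp_all
  then show ?thesis
    using assms \<open>h = 1\<close> e_mod_4 [of 1] by (simp add: chi_1)
qed

text \<open>The stationary class is that of all odd numbers, and primitivity forces \<open>chi 5 = - 1\<close>, hence
  \<open>chi 3 = - chi (- 1)\<close>.\<close>

theorem gauss_sum_8:
  assumes "m = 3"
  shows "gauss_sum chi (2 ^ m) = of_real (2 powr (real m / 2)) * omega powr (1 - chi (- 1))"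
proof -
  have hn: "h = 1" "n = 2" unfolding h_def n_def using assms by simp_all
  have x: "[1 = - b] (mod int 2 ^ h)"
    using odd_b by (auto simp: cong_iff_dvd_diff hn)
  have "chi 5 = e_mod 2 b"
    using chi_one_plus [of 1] by (simp add: hn)
  also have "\<dots> = e_mod 2 1"
    using odd_b by (intro e_mod_cong) (auto simp: cong_iff_dvd_diff)
  also have "\<dots> = - 1"
    by (simp add: e_mod_def)
  finally have chi5: "chi 5 = - 1" .
  have "chi 3 = chi (- 1 * 5)"
    using assms by (intro chi_cong) (simp add: cong_def)
  then have chi3: "chi 3 = - chi (- 1)"
    by (simp only: chi_mult chi5) simp
  have "chi (- 1) * chi (- 1) = 1"
    using chi_1 by (simp flip: chi_mult)
  then have sgn: "chi (- 1) = 1 \<or> chi (- 1) = - 1"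
    by (simp add: square_eq_1_iff)
  have e8: "e_mod (2 ^ m) 1 = omega"
    using e_mod_8 [of 1] assms by simp
  have "{0..<2::int} = {0, 1}" by auto
  then have G: "gauss_sum chi (2 ^ m) = 2 * (omega * (1 - \<i> * chi (- 1)))"
    using gauss_sum_reduced [OF x] e_mod_4 [of 1]
    by (simp add: hn local_factor_def chi_1 chi3 e8)
  have s2: "of_real (sqrt 2) * (of_real (sqrt 2) :: complex) = 2"
    by (simp flip: of_real_mult)
  have "omega \<noteq> 0" by (simp add: omega_def)
  have eq: "omega * (1 - \<i>) = of_real (sqrt 2)" "omega * (1 + \<i>) = of_real (sqrt 2) * \<i>"
    unfolding omega_eq using s2 by (simp_all add: field_simps)
  from sgn show ?thesis
  proof
    assume "chi (- 1) = 1"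
    then show ?thesis
      using G eq \<open>omega \<noteq> 0\<close> assms powr_half [of 2 3] by simp
  next
    assume c: "chi (- 1) = - 1"
    have "omega powr (1 - chi (- 1)) = omega powr (of_nat 2)"
      by (simp add: c)
    also have "\<dots> = \<i>"
      using \<open>omega \<noteq> 0\<close> omega_squared powr_nat' [of omega 2] by simp
    finally show ?thesis
      using G eq c assms powr_half [of 2 3] by simp
  qed
qed

theorem gauss_sum_16:
  assumes "m = 4" and c: "chi 5 = e_mod (2 ^ (m - 2)) c"
  shows "gauss_sum chi (2 ^ m) = of_real (2 powr (real m / 2)) * (chi (- c) * e_mod 16 (- c))"
proof -
  have hn: "h = 2" "n = 2" unfolding h_def n_def using assms by simp_all
  have "[c = b * five_quotient n] (mod 2 ^ h)"
    by (rule exponent_cong(1) [OF _ c]) (use assms in simp)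
  then have "[c = b] (mod 2 ^ h)"
    by (simp add: hn five_quotient_2)
  then have "[- c = - b] (mod int 2 ^ h)"
    using cong_uminus by simp
  then have "gauss_sum chi (2 ^ m) = of_nat (2 ^ h) * (chi (- c) * e_mod (2 ^ m) (- c))"
    using assms by (intro gauss_sum_even_exponent) simp_all
  then show ?thesis
    unfolding hn using assms by simp
qed

end

section \<open>Evaluation of the Gauss sum\<close>

lemma primitive_two_power_character_exists:
  assumes "m \<ge> 2" and "primitive_character (2 ^ m) chi"
  shows "\<exists>b. primitive_two_power_character m chi b"
proof -
  have "dirichlet_character (2 ^ m) chi"
    using assms(2) by (simp add: primitive_character_def)
  then interpret C: prime_power_character 2 m chi
    using assms(1) by unfold_locales simp_all
  obtain b where "\<And>t. chi (1 + int 2 ^ C.n * t) = e_mod (2 ^ C.h) (b * t)"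
    using C.chi_one_plus_exists by blast
  then have "primitive_two_power_character m chi b"
    using assms(2) by unfold_locales
  then show ?thesis ..
qed

theorem theorem2p1:
  fixes p m :: nat and chi :: "int \<Rightarrow> complex"
  assumes "prime p" and "m \<ge> 2" and "dirichlet_character (p ^ m) chi"
  shows
    "(\<not> primitive_character (p ^ m) chi \<longrightarrow> gauss_sum chi (p ^ m) = 0) \<and>
     (primitive_character (p ^ m) chi \<longrightarrow>
        (p \<noteq> 2 \<and> p ^ m \<noteq> 27 \<longrightarrow>
           (\<forall>(a::int) (r::int) (c::nat) (j::nat) (R::int).
              primitive_root (p ^ m) a \<and>
              a ^ totient p = 1 + r * int p \<and>
              1 \<le> c \<and> c \<le> totient (p ^ m) \<and> chi a = e_mod (totient (p ^ m)) (int c) \<and>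
              \<lceil>real m / 2\<rceil> \<le> int j \<and>
              a ^ totient (p ^ j) = 1 + R * int (p ^ j)
              \<longrightarrow>
              gauss_sum chi (p ^ m) =
                of_real (real p powr (real m / 2)) *
                chi (- int c * modular_inverse (int (p ^ m)) R) *
                e_mod (p ^ m) (- int c * modular_inverse (int (p ^ m)) R) *
                (of_int (Jacobi (- 2 * r * int c) p) ^ m * eps (p ^ m)))) \<and>
        (p = 2 \<and> m \<ge> 5 \<longrightarrow>
           (\<forall>(c::nat) (j::nat) (R::int).
              1 \<le> c \<and> chi 5 = e_mod (2 ^ (m - 2)) (int c) \<and>
              \<lceil>real m / 2\<rceil> + 2 \<le> int j \<and>
              5 ^ (2 ^ (j - 2)) = 1 + R * 2 ^ j
              \<longrightarrow>
              gauss_sum chi (p ^ m) =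
                of_real (real p powr (real m / 2)) *
                chi (- int c * modular_inverse (int (p ^ m)) R) *
                e_mod (p ^ m) (- int c * modular_inverse (int (p ^ m)) R) *
                (of_int (Jacobi 2 c) ^ m * omega ^ c))) \<and>
        (p = 2 \<and> m = 2 \<longrightarrow>
           gauss_sum chi (2 ^ m) = of_real (2 powr (real m / 2)) * \<i>) \<and>
        (p = 2 \<and> m = 3 \<longrightarrow>
           gauss_sum chi (2 ^ m) = of_real (2 powr (real m / 2)) * omega powr (1 - chi (- 1))) \<and>
        (p = 2 \<and> m = 4 \<longrightarrow>
           (\<forall>c::nat. 1 \<le> c \<and> chi 5 = e_mod (2 ^ (m - 2)) (int c) \<longrightarrow>
              gauss_sum chi (2 ^ m) =
                of_real (2 powr (real m / 2)) * (chi (- int c) * e_mod 16 (- int c)))))"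
proof (intro conjI impI)
  interpret C: prime_power_character p m chi
    using assms by unfold_locales
  assume "\<not> primitive_character (p ^ m) chi"
  then show "gauss_sum chi (p ^ m) = 0"
    by (rule C.gauss_sum_imprimitive)
next
  assume primitive: "primitive_character (p ^ m) chi" and p: "p \<noteq> 2 \<and> p ^ m \<noteq> 27"
  interpret C: prime_power_character p m chi
    using assms by unfold_locales
  obtain b where b: "\<And>t. chi (1 + int p ^ C.n * t) = e_mod (p ^ C.h) (b * t)"
    using C.chi_one_plus_exists by blast
  interpret P: primitive_prime_power_character p m chi b
    using primitive b by unfold_locales
  have "odd p"
    using p assms(1) prime_odd_nat C.p_gt_1 by (metis le_neq_implies_less Suc_leI One_nat_def numeral_2_eq_2)
  show "\<forall>(a::int) (r::int) (c::nat) (j::nat) (R::int).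
              primitive_root (p ^ m) a \<and>
              a ^ totient p = 1 + r * int p \<and>
              1 \<le> c \<and> c \<le> totient (p ^ m) \<and> chi a = e_mod (totient (p ^ m)) (int c) \<and>
              \<lceil>real m / 2\<rceil> \<le> int j \<and>
              a ^ totient (p ^ j) = 1 + R * int (p ^ j)
              \<longrightarrow>
              gauss_sum chi (p ^ m) =
                of_real (real p powr (real m / 2)) *
                chi (- int c * modular_inverse (int (p ^ m)) R) *
                e_mod (p ^ m) (- int c * modular_inverse (int (p ^ m)) R) *
                (of_int (Jacobi (- 2 * r * int c) p) ^ m * eps (p ^ m))"
  proof (intro allI impI, elim conjE)
    fix a r R :: int and c j :: nat
    assume a: "primitive_root (p ^ m) a" and r: "a ^ totient p = 1 + r * int p"
      and c: "chi a = e_mod (totient (p ^ m)) (int c)"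
      and j: "\<lceil>real m / 2\<rceil> \<le> int j" and R: "a ^ totient (p ^ j) = 1 + R * int (p ^ j)"
    have "m \<le> 2 * j"
      using j by linarith
    then have nj: "C.n \<le> j"
      unfolding C.n_def by linarith
    have R': "a ^ totient (p ^ j) = 1 + R * int p ^ j"
      using R by simp
    have "R = euler_quotient p a j"
      using R' C.p_pos by (intro euler_quotient_unique)
    moreover have "[euler_quotient p a j = euler_quotient p a 1] (mod int p)"
      using euler_quotient_cong [OF assms(1) \<open>odd p\<close> euler_quotient_primitive_root(1) [OF assms(1,2) a], of 1 j]
        nj C.n_pos by simp
    ultimately have "\<not> int p dvd R"
      using euler_quotient_primitive_root(2) [OF assms(1,2) a] cong_dvd_iff by blast
    then have "[R * modular_inverse (int (p ^ m)) R = 1] (mod int (p ^ m))"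
      using assms(2) C.coprime_prime_power_iff [of m R] by (intro cong_modular_inverse1) simp
    then have "[- int c * (R * modular_inverse (int (p ^ m)) R) = - int c * 1] (mod int (p ^ m))"
      by (rule cong_scalar_left)
    then have x: "[- int c * modular_inverse (int (p ^ m)) R * R = - int c] (mod int p ^ m)"
      by (simp add: mult_ac)
    have "Jacobi (- 2 * r * int c) p = Legendre (- 2 * r * int c) (int p)"
      using assms(1) by (simp add: Jacobi_def prime_factorization_prime)
    then show "gauss_sum chi (p ^ m) =
                of_real (real p powr (real m / 2)) *
                chi (- int c * modular_inverse (int (p ^ m)) R) *
                e_mod (p ^ m) (- int c * modular_inverse (int (p ^ m)) R) *
                (of_int (Jacobi (- 2 * r * int c) p) ^ m * eps (p ^ m))"
      using P.gauss_sum_odd_prime [OF \<open>odd p\<close> _ a r c nj R' x] p by simp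
  qed
next
  assume primitive: "primitive_character (p ^ m) chi" and p: "p = 2 \<and> m \<ge> 5"
  obtain b where P: "primitive_two_power_character m chi b"
    using primitive_two_power_character_exists assms primitive p by blast
  then interpret P: primitive_two_power_character m chi b .
  show "\<forall>(c::nat) (j::nat) (R::int).
              1 \<le> c \<and> chi 5 = e_mod (2 ^ (m - 2)) (int c) \<and>
              \<lceil>real m / 2\<rceil> + 2 \<le> int j \<and>
              5 ^ (2 ^ (j - 2)) = 1 + R * 2 ^ j
              \<longrightarrow>
              gauss_sum chi (p ^ m) =
                of_real (real p powr (real m / 2)) *
                chi (- int c * modular_inverse (int (p ^ m)) R) *
                e_mod (p ^ m) (- int c * modular_inverse (int (p ^ m)) R) *
                (of_int (Jacobi 2 c) ^ m * omega ^ c)"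
  proof (intro allI impI, elim conjE)
    fix R :: int and c j :: nat
    assume c: "chi 5 = e_mod (2 ^ (m - 2)) (int c)"
      and j: "\<lceil>real m / 2\<rceil> + 2 \<le> int j" and R: "5 ^ (2 ^ (j - 2)) = 1 + R * 2 ^ j"
    have "m + 4 \<le> 2 * j"
      using j by linarith
    then have nj: "P.n + 2 \<le> j"
      unfolding P.n_def by linarith
    have "odd R"
      using odd_five_quotient [of j] five_quotient_unique [OF R] nj by simp
    then have "[R * modular_inverse (2 ^ m) R = 1] (mod 2 ^ m)"
      by (intro cong_modular_inverse1) simp
    then have "[- int c * (R * modular_inverse (2 ^ m) R) = - int c * 1] (mod 2 ^ m)"
      by (rule cong_scalar_left)
    then have x: "[- int c * modular_inverse (2 ^ m) R * R = - int c] (mod 2 ^ m)"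
      by (simp add: mult_ac)
    show "gauss_sum chi (p ^ m) =
                of_real (real p powr (real m / 2)) *
                chi (- int c * modular_inverse (int (p ^ m)) R) *
                e_mod (p ^ m) (- int c * modular_inverse (int (p ^ m)) R) *
                (of_int (Jacobi 2 c) ^ m * omega ^ c)"
      using P.gauss_sum_two_power [OF _ c nj R x] p by simp
  qed
next
  assume primitive: "primitive_character (p ^ m) chi" and p: "p = 2 \<and> m = 2"
  obtain b where "primitive_two_power_character m chi b"
    using primitive_two_power_character_exists assms primitive p by blast
  then show "gauss_sum chi (2 ^ m) = of_real (2 powr (real m / 2)) * \<i>"
    using p by (intro primitive_two_power_character.gauss_sum_4) auto
next
  assume primitive: "primitive_character (p ^ m) chi" and p: "p = 2 \<and> m = 3"
  obtain b where "primitive_two_power_character m chi b"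
    using primitive_two_power_character_exists assms primitive p by blast
  then show "gauss_sum chi (2 ^ m) = of_real (2 powr (real m / 2)) * omega powr (1 - chi (- 1))"
    using p by (intro primitive_two_power_character.gauss_sum_8) auto
next
  assume primitive: "primitive_character (p ^ m) chi" and p: "p = 2 \<and> m = 4"
  obtain b where P: "primitive_two_power_character m chi b"
    using primitive_two_power_character_exists assms primitive p by blast
  show "\<forall>c::nat. 1 \<le> c \<and> chi 5 = e_mod (2 ^ (m - 2)) (int c) \<longrightarrow>
              gauss_sum chi (2 ^ m) =
                of_real (2 powr (real m / 2)) * (chi (- int c) * e_mod 16 (- int c))"
    using primitive_two_power_character.gauss_sum_16 [OF P] p by blast
qed

end
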